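(* Let $\omega=(\omega_n)$ be an increasing sequence of algebra weights on $\mathbb R^+$ such that, for every $n\in\mathbb N$, $\omega_n(t)\to\infty$ as $t\to\infty$, $\lim_{t\to\infty}\omega_n(t)^{1/t}=1$, and $\sup_{t\in\mathbb R^+}\omega_{n+1}(t)/\omega_n(t)=\infty$. Assume that for every $n\in\mathbb N$ there exists $m\in\mathbb N$ such that $$\sup_{t\in\mathbb R^+}\frac{t\omega_n(t)}{\omega_m(t)}<\infty,$$ and let $\mu\in B(\omega)$. Then the derivation $\overline{D}_{\mu}$ on $B(\omega)$, given by $\overline{D}_\mu\nu=X\nu*\mu$ $(\nu\in B(\omega))$, is weak-star continuous on $B(\omega)$.
   Context: All spaces are complex and $\mathbb R^+=[0,\infty)$. An algebra weight on $\mathbb R^+$ is a positive Borel function $w$ on $\mathbb R^+$ such that $w$ and $1/w$ are locally bounded, $w$ is right continuous, $w(t+s)\le w(t)w(s)$ for all $t,s\in\mathbb R^+$, and $w(0)=1$. For an algebra weight $w$, $M(w)$ is the Banach algebra (under convolution) of locally finite complex Borel measures $\mu$ on $\mathbb R^+$ with $\|\mu\|_w=\int_{\mathbb R^+}w(t)\,d|\mu|(t)<\infty$. For a sequence $\omega=(\omega_n)$ as in the statement, $B(\omega)=\bigcap_nM(\omega_n)$, equipped with the increasing sequence of norms $\|\cdot\|_n=\|\cdot\|_{\omega_n}$, is a Fréchet algebra under convolution, where $\int_{\mathbb R^+} h\,d(\nu*\mu)=\int_{\mathbb R^+}\int_{\mathbb R^+}h(t+s)\,d\mu(s)\,d\nu(t)$.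 $X$ is given by $d(X\nu)(t)=t\,d\nu(t)$. Under the stated assumption it is known that $\overline D_\mu$ is a continuous derivation on $B(\omega)$. $C_0(1/\omega_n)$ is the Banach space of continuous functions $h$ on $\mathbb R^+$ for which $h/\omega_n$ vanishes at infinity, with norm $\sup_t|h(t)|/\omega_n(t)$, and $D(1/\omega)=\bigcup_{n\in\mathbb N}C_0(1/\omega_n)$ with the inductive limit topology. $B(\omega)$ is identified with the dual of $D(1/\omega)$ via $\langle h,\nu\rangle=\int_{\mathbb R^+}h\,d\nu$, and "weak-star" refers to this duality, i.e. to the topology $\sigma(B(\omega),D(1/\omega))$. *)

theory Defs
  imports "HOL-Analysis.Analysis"
begin

abbreviation Rplus :: "real measure" where
  "Rplus \<equiv> restrict_space borel {0..}"

definition algebra_weight :: "(real \<Rightarrow> real) \<Rightarrow> bool" where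
  "algebra_weight w \<longleftrightarrow>
     w \<in> borel_measurable Rplus \<and>
     (\<forall>t\<ge>0. 0 < w t) \<and>
     (\<forall>T\<ge>0. bounded (w ` {0..T}) \<and> bounded ((\<lambda>t. 1 / w t) ` {0..T})) \<and>
     (\<forall>t\<ge>0. continuous (at_right t) w) \<and>
     (\<forall>t\<ge>0. \<forall>s\<ge>0. w (t + s) \<le> w t * w s) \<and>
     w 0 = 1"

definition bounded_borel :: "real set set" where
  "bounded_borel = {A \<in> sets Rplus. bounded A}"

text \<open>
  A locally finite complex measure need not assign a value to an unbounded set, so it is a set
  function on the bounded Borel subsets of the half line. It is put to \<open>0\<close> on all other sets, so
  that two measures are equal iff they are equal as functions.
\<close>

definition lf_measures :: "(real set \<Rightarrow> complex) set" where
  "lf_measures = {\<nu>.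
     (\<forall>A. A \<notin> bounded_borel \<longrightarrow> \<nu> A = 0) \<and>
     (\<forall>A :: nat \<Rightarrow> real set. range A \<subseteq> bounded_borel \<longrightarrow> disjoint_family A \<longrightarrow>
        (\<Union>i. A i) \<in> bounded_borel \<longrightarrow> (\<lambda>i. \<nu> (A i)) sums \<nu> (\<Union>i. A i))}"

text \<open>
  The total variation, and the positive part of the Jordan decomposition of a real set function.
  For (the real and imaginary parts of) elements of \<^const>\<open>lf_measures\<close>, the suprema below are
  countably additive in \<open>A\<close>, so they are the values of the measures.
\<close>

definition total_variation :: "(real set \<Rightarrow> complex) \<Rightarrow> real measure" where
  "total_variation \<nu> = measure_of {0..} (sets Rplus)
     (\<lambda>A. SUP P \<in> {P. finite P \<and> disjoint P \<and> P \<subseteq> bounded_borel \<and> \<Union>P \<subseteq> A}.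
        ennreal (\<Sum>B\<in>P. norm (\<nu> B)))"

definition jordan_pos :: "(real set \<Rightarrow> real) \<Rightarrow> real measure" where
  "jordan_pos \<sigma> = measure_of {0..} (sets Rplus)
     (\<lambda>A. SUP B \<in> {B \<in> bounded_borel. B \<subseteq> A}. ennreal (\<sigma> B))"

definition jordan_neg :: "(real set \<Rightarrow> real) \<Rightarrow> real measure" where
  "jordan_neg \<sigma> = jordan_pos (\<lambda>A. - \<sigma> A)"

definition cintegral :: "(real set \<Rightarrow> complex) \<Rightarrow> (real \<Rightarrow> complex) \<Rightarrow> complex" where
  "cintegral \<nu> h =
     (integral\<^sup>L (jordan_pos (\<lambda>A. Re (\<nu> A))) h - integral\<^sup>L (jordan_neg (\<lambda>A. Re (\<nu> A))) h)
     + \<i> * (integral\<^sup>L (jordan_pos (\<lambda>A. Im (\<nu> A))) h - integral\<^sup>L (jordan_neg (\<lambda>A. Im (\<nu> A))) h)"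

definition wnorm :: "(real \<Rightarrow> real) \<Rightarrow> (real set \<Rightarrow> complex) \<Rightarrow> ennreal" where
  "wnorm w \<nu> = (\<integral>\<^sup>+ t. ennreal (w t) \<partial>total_variation \<nu>)"

definition M_alg :: "(real \<Rightarrow> real) \<Rightarrow> (real set \<Rightarrow> complex) set" where
  "M_alg w = {\<nu> \<in> lf_measures. wnorm w \<nu> < \<infinity>}"

definition B_alg :: "(nat \<Rightarrow> real \<Rightarrow> real) \<Rightarrow> (real set \<Rightarrow> complex) set" where
  "B_alg \<omega> = (\<Inter>n. M_alg (\<omega> n))"

text \<open>
  The formula for the integral of a function against \<open>\<nu> * \<mu>\<close>, read for indicator functions.
\<close>

definition convolution ::
  "(real set \<Rightarrow> complex) \<Rightarrow> (real set \<Rightarrow> complex) \<Rightarrow> real set \<Rightarrow> complex" where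
  "convolution \<nu> \<mu> A =
     (if A \<in> bounded_borel
      then cintegral \<nu> (\<lambda>t. cintegral \<mu> (\<lambda>s. indicator A (t + s))) else 0)"

definition X_op :: "(real set \<Rightarrow> complex) \<Rightarrow> real set \<Rightarrow> complex" where
  "X_op \<nu> A =
     (if A \<in> bounded_borel then cintegral \<nu> (\<lambda>t. indicator A t * complex_of_real t) else 0)"

definition Dbar :: "(real set \<Rightarrow> complex) \<Rightarrow> (real set \<Rightarrow> complex) \<Rightarrow> real set \<Rightarrow> complex" where
  "Dbar \<mu> \<nu> = convolution (X_op \<nu>) \<mu>"

text \<open>
  Values off the half line are irrelevant to \<^const>\<open>cintegral\<close> and are left arbitrary.
\<close>

definition C0_inv :: "(real \<Rightarrow> real) \<Rightarrow> (real \<Rightarrow> complex) set" where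
  "C0_inv w = {h. continuous_on {0..} h \<and> ((\<lambda>t. h t / complex_of_real (w t)) \<longlongrightarrow> 0) at_top}"

definition D_inv :: "(nat \<Rightarrow> real \<Rightarrow> real) \<Rightarrow> (real \<Rightarrow> complex) set" where
  "D_inv \<omega> = (\<Union>n. C0_inv (\<omega> n))"

text \<open>
  The topology \<open>\<sigma>(B(\<omega>), D(1/\<omega>))\<close>: the coarsest one on \<open>B(\<omega>)\<close> for which all \<open>\<nu> \<mapsto> \<langle>h, \<nu>\<rangle>\<close> are
  continuous.
\<close>

definition weak_star :: "(nat \<Rightarrow> real \<Rightarrow> real) \<Rightarrow> (real set \<Rightarrow> complex) topology" where
  "weak_star \<omega> = topology_generated_by
     {{\<nu> \<in> B_alg \<omega>. cintegral \<nu> h \<in> U} | h U. h \<in> D_inv \<omega> \<and> open U}"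

lemma topspace_weak_star: "topspace (weak_star \<omega>) = B_alg \<omega>"
proof -
  have "(\<lambda>_. 0) \<in> D_inv \<omega>"
    by (simp add: D_inv_def C0_inv_def)
  then have "B_alg \<omega> \<in> {{\<nu> \<in> B_alg \<omega>. cintegral \<nu> h \<in> U} | h U. h \<in> D_inv \<omega> \<and> open U}"
    by (intro CollectI exI[of _ "\<lambda>_. 0"] exI[of _ UNIV]) auto
  then show ?thesis
    unfolding weak_star_def topology_generated_by_topspace by blast
qed

end

theory Submission
  imports Defs
begin

text \<open>
  The map \<open>\<nu> \<mapsto> X \<nu> * \<mu>\<close> is the transpose of \<open>h \<mapsto> (t \<mapsto> t \<integral> h(t + s) d\<mu>(s))\<close>, so it suffices that this map
  sends \<open>D(1/\<omega>)\<close> into itself. If \<open>h\<close> is in \<open>C_0(1/\<omega>_n)\<close>, dominated convergence with the majorant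
  \<open>\<bar>h(t + s)\<bar> \<le> C \<omega>_n(t) \<omega>_n(s)\<close> puts the inner integral in \<open>C_0(1/\<omega>_n)\<close> again, and the factor \<open>t\<close> is
  absorbed by passing from \<open>\<omega>_n\<close> to \<open>\<omega>_m\<close>. The duality identity itself is Fubini's theorem.
\<close>

section \<open>Jordan decomposition and total variation\<close>

text \<open>Fubini's theorem concerns positive measures, while \<nu> and \<mu> are set functions on
  bounded sets, with integrals defined through four suprema. The bridge is to write each as a
  complex density over a sigma-finite positive measure. For this the suprema must be countably
  additive, they must be finite on bounded sets so that Jordan differences make sense, and each
  Jordan part must lie below the total variation, hence have a Radon-Nikodym density. No polar
  decomposition is sought: the density assembled from the four parts has a weighted integral of at
  most 4 times the norm, and the later estimates ask only for finiteness. Conversely, every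
  representation by a density, on whatever space, computes \<open>cintegral\<close> correctly. So
  \<nu>, X \<nu> and X \<nu> * \<mu> all become Lebesgue integrals over two fixed spaces and their
  product, where the factor t moves freely between the measure and the test function.\<close>

definition bounded_additive :: "(real set \<Rightarrow> 'a::real_normed_vector) \<Rightarrow> bool" where
  "bounded_additive \<sigma> \<longleftrightarrow>
     (\<forall>A :: nat \<Rightarrow> real set. range A \<subseteq> bounded_borel \<longrightarrow> disjoint_family A \<longrightarrow>
        (\<Union>i. A i) \<in> bounded_borel \<longrightarrow> (\<lambda>i. \<sigma> (A i)) sums \<sigma> (\<Union>i. A i))"

lemma lf_measures_iff:
  "\<nu> \<in> lf_measures \<longleftrightarrow> (\<forall>A. A \<notin> bounded_borel \<longrightarrow> \<nu> A = 0) \<and> bounded_additive \<nu>"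
  unfolding lf_measures_def bounded_additive_def mem_Collect_eq by (rule refl)

lemma space_Rplus [simp]: "space Rplus = {0..}" by (simp add: space_restrict_space)

lemma bounded_borel_subset:
  assumes "A \<in> bounded_borel" "B \<subseteq> A" "B \<in> sets Rplus"
  shows "B \<in> bounded_borel"
  using assms bounded_subset[of A B] unfolding bounded_borel_def by simp

lemma bounded_borel_simps [simp]:
  "{} \<in> bounded_borel"
  "A \<in> bounded_borel \<Longrightarrow> B \<in> bounded_borel \<Longrightarrow> A \<union> B \<in> bounded_borel"
  "A \<in> bounded_borel \<Longrightarrow> A \<in> sets Rplus"
  unfolding bounded_borel_def by (simp_all add: sets.Un)

lemma bounded_borel_Int_Diff [simp]:
  "A \<in> bounded_borel \<Longrightarrow> B \<in> sets Rplus \<Longrightarrow> A \<inter> B \<in> bounded_borel"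
  "A \<in> bounded_borel \<Longrightarrow> B \<in> sets Rplus \<Longrightarrow> B \<inter> A \<in> bounded_borel"
  "A \<in> bounded_borel \<Longrightarrow> B \<in> sets Rplus \<Longrightarrow> A - B \<in> bounded_borel"
  by (rule bounded_borel_subset[of A]; simp add: sets.Int sets.Diff)+

lemma bounded_borel_Icc [simp]: "{0..T} \<in> bounded_borel"
  unfolding bounded_borel_def by (simp add: sets_restrict_space_iff)

lemma bounded_borel_upper_bound:
  assumes "A \<in> bounded_borel"
  shows "\<exists>T\<ge>0. A \<subseteq> {0..T}"
proof -
  have "bounded A" using assms unfolding bounded_borel_def by blast
  then obtain b where b: "\<forall>x\<in>A. \<bar>x\<bar> \<le> b"
    unfolding bounded_iff real_norm_def by (rule exE)
  have nonneg: "A \<subseteq> {0..}"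
    using sets.sets_into_space[OF bounded_borel_simps(3)[OF assms]] unfolding space_Rplus .
  have "x \<in> {0..max b 0}" if "x \<in> A" for x
    using bspec[OF b that] subsetD[OF nonneg that] by simp
  then have "A \<subseteq> {0..max b 0}" by (rule subsetI)
  then show ?thesis by (intro exI[of _ "max b 0"] conjI) simp_all
qed

context
  fixes \<sigma> :: "real set \<Rightarrow> 'a::real_normed_vector"
  assumes \<sigma>: "bounded_additive \<sigma>"
begin

lemma bounded_additive_empty [simp]: "\<sigma> {} = 0"
proof -
  have "(\<lambda>i::nat. \<sigma> {}) sums \<sigma> (\<Union>i::nat. {})"
    using \<sigma>[unfolded bounded_additive_def, rule_format, of "\<lambda>_. {}"]
    by (auto simp: disjoint_family_on_def)
  then show ?thesis using summable_const_iff[of "\<sigma> {}"] by (simp add: sums_summable)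
qed

lemma bounded_additive_Un:
  assumes "A \<in> bounded_borel" "B \<in> bounded_borel" "A \<inter> B = {}"
  shows "\<sigma> (A \<union> B) = \<sigma> A + \<sigma> B"
proof -
  have "(\<lambda>i. \<sigma> (binaryset A B i)) sums \<sigma> (\<Union>i. binaryset A B i)"
  proof (rule \<sigma>[unfolded bounded_additive_def, rule_format])
    show "disjoint_family (binaryset A B)"
      using assms by (auto simp: disjoint_family_on_def binaryset_def)
  qed (use assms in \<open>auto simp: range_binaryset_eq UN_binaryset_eq\<close>)
  then show ?thesis
    using binaryset_sums[of \<sigma> A B] by (simp add: UN_binaryset_eq sums_unique2)
qed

lemma bounded_additive_Diff:
  assumes "A \<in> bounded_borel" "B \<in> sets Rplus" "B \<subseteq> A"
  shows "\<sigma> (A - B) = \<sigma> A - \<sigma> B"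
proof -
  have "(A - B) \<inter> B = {}" "(A - B) \<union> B = A" using assms by auto
  then show ?thesis
    using bounded_additive_Un[of "A - B" B] bounded_borel_subset[OF assms(1,3,2)] assms
    by (simp add: algebra_simps)
qed

text \<open>The pieces \<open>A i\<close> may be unbounded, where \<sigma> carries no information,
  so only their traces on the bounded set \<open>B\<close> are measured. This reduces countable
  subadditivity of the variations on all Borel sets to additivity on bounded ones.\<close>

lemma bounded_additive_sums_Int:
  assumes "B \<in> bounded_borel" "range A \<subseteq> sets Rplus" "disjoint_family A" "B \<subseteq> (\<Union>i::nat. A i)"
  shows "(\<lambda>i. \<sigma> (B \<inter> A i)) sums \<sigma> B"
proof -
  have "(\<Union>i. B \<inter> A i) = B" using assms by auto
  moreover have "disjoint_family (\<lambda>i. B \<inter> A i)"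
    using assms(3) by (auto simp: disjoint_family_on_def)
  moreover have "range (\<lambda>i. B \<inter> A i) \<subseteq> bounded_borel"
    using assms by auto
  ultimately show ?thesis
    using \<sigma>[unfolded bounded_additive_def, rule_format, of "\<lambda>i. B \<inter> A i"] assms(1) by (simp only:)
qed

end

lemma bounded_additive_bounded_linear:
  assumes "bounded_additive \<sigma>" "bounded_linear f"
  shows "bounded_additive (\<lambda>A. f (\<sigma> A))"
  using assms(1) unfolding bounded_additive_def by (auto intro!: bounded_linear.sums[OF assms(2)])

text \<open>\<open>measure_of\<close> keeps a set function only if it is a measure. For a supremum
  the two halves of countable additivity have different sources: monotonicity and superadditivity on
  two disjoint sets bound every partial sum from above, while \<open>sub\<close> is obtained by
  cutting a single competitor into pieces.\<close>

lemma emeasure_measure_of_superadditive: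
  assumes zero: "F {} = 0"
    and mono: "\<And>A B. A \<subseteq> B \<Longrightarrow> F A \<le> F B"
    and super: "\<And>A B. A \<in> sets M \<Longrightarrow> B \<in> sets M \<Longrightarrow> A \<inter> B = {} \<Longrightarrow> F A + F B \<le> F (A \<union> B)"
    and sub: "\<And>A. range A \<subseteq> sets M \<Longrightarrow> disjoint_family A \<Longrightarrow> F (\<Union>i. A i) \<le> (\<Sum>i. F (A i))"
    and A: "A \<in> sets M"
  shows "emeasure (measure_of (space M) (sets M) F) A = F A"
proof (rule emeasure_measure_of_sigma[OF sets.sigma_algebra_axioms _ _ A])
  show "positive (sets M) F" using zero by (simp add: positive_def)
  show "countably_additive (sets M) F"
  proof (rule countably_additiveI)
    fix A :: "nat \<Rightarrow> 'a set" assume A: "range A \<subseteq> sets M" "disjoint_family A"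
    have fin: "(\<Sum>i<n. F (A i)) \<le> F (\<Union>i<n. A i)" for n
    proof (induction n)
      case (Suc n)
      have "(\<Sum>i<Suc n. F (A i)) \<le> F (\<Union>i<n. A i) + F (A n)"
        using Suc by (simp add: add_right_mono)
      also have "\<dots> \<le> F ((\<Union>i<n. A i) \<union> A n)"
      proof (rule super)
        show "(\<Union>i<n. A i) \<in> sets M" "A n \<in> sets M"
          using A(1) by (auto intro!: sets.finite_UN)
        have "A i \<inter> A n = {}" if "i < n" for i
          using A(2) that by (intro disjoint_family_onD) auto
        then show "(\<Union>i<n. A i) \<inter> A n = {}" by blast
      qed
      also have "(\<Union>i<n. A i) \<union> A n = (\<Union>i<Suc n. A i)" by (auto simp: lessThan_Suc)
      finally show ?case .
    qed (use zero in simp)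
    have "(\<Sum>i. F (A i)) \<le> F (\<Union>i. A i)"
      by (rule suminf_le_const[OF summableI]) (rule order_trans[OF fin mono], blast)
    with sub[OF A] show "(\<Sum>i. F (A i)) = F (\<Union>i. A i)" by (rule antisym[rotated])
  qed
qed

lemma sums_ennreal_le:
  fixes f :: "nat \<Rightarrow> real"
  assumes "f sums s" "\<And>i. ennreal (f i) \<le> g i"
  shows "ennreal s \<le> (\<Sum>i. g i)"
proof -
  have "(\<lambda>n. ennreal (\<Sum>i<n. f i)) \<longlonglongrightarrow> ennreal s"
    using assms(1) by (intro tendsto_ennrealI) (simp add: sums_def)
  moreover have "ennreal (\<Sum>i<n. f i) \<le> (\<Sum>i. g i)" for n
  proof -
    \<comment> \<open>\<open>ennreal\<close> sends negative reals to 0 and is additive only on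
      nonnegative ones, so negative terms are raised to 0 before the sum is split.\<close>
    have "ennreal (\<Sum>i<n. f i) \<le> ennreal (\<Sum>i<n. max 0 (f i))"
      by (intro ennreal_leI sum_mono) auto
    also have "\<dots> = (\<Sum>i<n. ennreal (max 0 (f i)))" by simp
    also have "\<dots> = (\<Sum>i<n. ennreal (f i))"
      by (intro sum.cong refl) (auto simp: max_def ennreal_neg)
    also have "\<dots> \<le> (\<Sum>i<n. g i)" by (intro sum_mono assms)
    also have "\<dots> \<le> (\<Sum>i. g i)" by (rule sum_le_suminf) auto
    finally show ?thesis .
  qed
  ultimately show ?thesis by (intro LIMSEQ_le_const2) auto
qed

lemma SUP_add_SUP_le_ennreal:
  fixes f :: "'i \<Rightarrow> ennreal" and g :: "'j \<Rightarrow> ennreal"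
  assumes "I \<noteq> {}" "J \<noteq> {}" "\<And>i j. i \<in> I \<Longrightarrow> j \<in> J \<Longrightarrow> f i + g j \<le> c"
  shows "(SUP i\<in>I. f i) + (SUP j\<in>J. g j) \<le> c"
proof -
  have "(SUP i\<in>I. f i) + (SUP j\<in>J. g j) = (SUP i\<in>I. SUP j\<in>J. f i + g j)"
    unfolding ennreal_SUP_add_right[OF assms(2), symmetric] ennreal_SUP_add_left[OF assms(1)] ..
  also have "\<dots> \<le> c" using assms(3) by (intro SUP_least)
  finally show ?thesis .
qed

lemma sets_measure_of_Rplus: "sets (measure_of {0..} (sets Rplus) F) = sets Rplus"
  using sets.sets_measure_of_eq[of Rplus F] unfolding space_Rplus .

lemma sets_jordan_pos [simp, measurable_cong]: "sets (jordan_pos \<sigma>) = sets Rplus"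
  unfolding jordan_pos_def by (rule sets_measure_of_Rplus)

lemma sets_jordan_neg [simp, measurable_cong]: "sets (jordan_neg \<sigma>) = sets Rplus"
  unfolding jordan_neg_def by (rule sets_jordan_pos)

lemma sets_total_variation [simp, measurable_cong]: "sets (total_variation \<nu>) = sets Rplus"
  unfolding total_variation_def by (rule sets_measure_of_Rplus)

lemma space_jordan_pos [simp]: "space (jordan_pos \<sigma>) = {0..}"
  and space_jordan_neg [simp]: "space (jordan_neg \<sigma>) = {0..}"
  and space_total_variation [simp]: "space (total_variation \<nu>) = {0..}"
  using sets_eq_imp_space_eq[OF sets_jordan_pos] sets_eq_imp_space_eq[OF sets_jordan_neg]
    sets_eq_imp_space_eq[OF sets_total_variation] by (simp_all only: space_Rplus)

lemma emeasure_jordan_pos: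
  fixes \<sigma> :: "real set \<Rightarrow> real"
  assumes \<sigma>: "bounded_additive \<sigma>" and A: "A \<in> sets Rplus"
  shows "emeasure (jordan_pos \<sigma>) A = (SUP B \<in> {B \<in> bounded_borel. B \<subseteq> A}. ennreal (\<sigma> B))"
proof -
  let ?S = "\<lambda>A. {B \<in> bounded_borel. B \<subseteq> A}"
  let ?F = "\<lambda>A. SUP B \<in> ?S A. ennreal (\<sigma> B)"
  have ne: "?S A \<noteq> {}" for A by (auto intro!: exI[of _ "{}"])
  have "emeasure (measure_of (space Rplus) (sets Rplus) ?F) A = ?F A"
  proof (rule emeasure_measure_of_superadditive[OF _ _ _ _ A])
    have "?S {} = {{}}" by auto
    then show "?F {} = 0" using \<sigma> by simp
    show "?F A \<le> ?F B" if "A \<subseteq> B" for A B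
      using that by (intro SUP_subset_mono) auto
    show "?F A + ?F B \<le> ?F (A \<union> B)" if "A \<inter> B = {}" for A B
    proof -
      have "ennreal (\<sigma> C) + ennreal (\<sigma> D) \<le> ?F (A \<union> B)" if C: "C \<in> ?S A" and D: "D \<in> ?S B" for C D
      proof -
        \<comment> \<open>A competitor of negative value counts as 0 on the left but would lower the
          value of the union, so it is replaced by the empty set.\<close>
        let ?C = "if \<sigma> C \<ge> 0 then C else {}" and ?D = "if \<sigma> D \<ge> 0 then D else {}"
        have "ennreal (\<sigma> C) + ennreal (\<sigma> D) = ennreal (\<sigma> ?C + \<sigma> ?D)"
          using \<sigma> by (auto simp: ennreal_neg)
        also have "\<sigma> ?C + \<sigma> ?D = \<sigma> (?C \<union> ?D)"
          using C D \<open>A \<inter> B = {}\<close> by (intro bounded_additive_Un[OF \<sigma>, symmetric]) auto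
        also have "ennreal \<dots> \<le> ?F (A \<union> B)"
          using C D by (intro SUP_upper) auto
        finally show ?thesis .
      qed
      then show ?thesis
        by (intro SUP_add_SUP_le_ennreal ne)
    qed
    show "?F (\<Union>i. A i) \<le> (\<Sum>i. ?F (A i))"
      if "range A \<subseteq> sets Rplus" "disjoint_family A" for A
    proof (rule SUP_least)
      fix B assume "B \<in> ?S (\<Union>i. A i)"
      with that show "ennreal (\<sigma> B) \<le> (\<Sum>i. ?F (A i))"
        by (intro sums_ennreal_le[OF bounded_additive_sums_Int[OF \<sigma>, of B A]] SUP_upper) auto
    qed
  qed
  then show ?thesis by (simp add: jordan_pos_def)
qed

lemma emeasure_total_variation:
  assumes \<nu>: "bounded_additive \<nu>" and A: "A \<in> sets Rplus"
  shows "emeasure (total_variation \<nu>) A =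
    (SUP P \<in> {P. finite P \<and> disjoint P \<and> P \<subseteq> bounded_borel \<and> \<Union>P \<subseteq> A}. ennreal (\<Sum>B\<in>P. norm (\<nu> B)))"
proof -
  let ?S = "\<lambda>A. {P. finite P \<and> disjoint P \<and> P \<subseteq> bounded_borel \<and> \<Union>P \<subseteq> A}"
  let ?F = "\<lambda>A. SUP P \<in> ?S A. ennreal (\<Sum>B\<in>P. norm (\<nu> B))"
  have ne: "?S A \<noteq> {}" for A by (auto intro!: exI[of _ "{}"])
  have "emeasure (measure_of (space Rplus) (sets Rplus) ?F) A = ?F A"
  proof (rule emeasure_measure_of_superadditive[OF _ _ _ _ A])
    have "(\<Sum>B\<in>P. norm (\<nu> B)) = 0" if "P \<in> ?S {}" for P
      using that \<nu> by (intro sum.neutral) auto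
    then have "?F {} = (SUP P \<in> ?S {}. 0)" by (intro SUP_cong) auto
    then show "?F {} = 0" by (simp only: SUP_const[OF ne])
    show "?F A \<le> ?F B" if "A \<subseteq> B" for A B
      using that by (intro SUP_subset_mono) auto
    show "?F A + ?F B \<le> ?F (A \<union> B)" if "A \<inter> B = {}" for A B
    proof -
      have "ennreal (\<Sum>B\<in>P. norm (\<nu> B)) + ennreal (\<Sum>B\<in>Q. norm (\<nu> B)) \<le> ?F (A \<union> B)"
        if P: "P \<in> ?S A" and Q: "Q \<in> ?S B" for P Q
      proof -
        \<comment> \<open>Families inside disjoint sets can share only the empty set, on which \<nu>
          vanishes, so the sum over \<open>P \<union> Q\<close> counts nothing twice.\<close>
        have PQ: "C = {}" if "C \<in> P" "C \<in> Q" for C using that P Q \<open>A \<inter> B = {}\<close> by blast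
        have "(\<Sum>B\<in>P\<inter>Q. norm (\<nu> B)) = 0"
          using PQ bounded_additive_empty[OF \<nu>] by (intro sum.neutral) force
        then have eq: "ennreal (\<Sum>B\<in>P. norm (\<nu> B)) + ennreal (\<Sum>B\<in>Q. norm (\<nu> B))
            = ennreal (\<Sum>B\<in>P\<union>Q. norm (\<nu> B))"
          using P Q sum.union_inter[of P Q "\<lambda>B. norm (\<nu> B)"]
          by (subst ennreal_plus[symmetric]) (auto intro: sum_nonneg)
        have "P \<union> Q \<in> ?S (A \<union> B)"
        proof -
          have "disjoint (P \<union> Q)"
            using P Q \<open>A \<inter> B = {}\<close> by (intro disjoint_union) blast+
          then show ?thesis using P Q by auto
        qed
        then have "ennreal (\<Sum>B\<in>P\<union>Q. norm (\<nu> B)) \<le> ?F (A \<union> B)"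
          by (rule SUP_upper)
        with eq show ?thesis by (simp only:)
      qed
      then show ?thesis
        by (intro SUP_add_SUP_le_ennreal ne)
    qed
    show "?F (\<Union>i. A i) \<le> (\<Sum>i. ?F (A i))"
      if A: "range A \<subseteq> sets Rplus" "disjoint_family A" for A
    proof (rule SUP_least)
      fix P assume P: "P \<in> ?S (\<Union>i. A i)"
      have piece: "ennreal (\<Sum>B\<in>P. norm (\<nu> (B \<inter> A i))) \<le> ?F (A i)" for i
      proof -
        \<comment> \<open>Different blocks of \<open>P\<close> can have the same trace on
          \<open>A i\<close> only if that trace is empty. The collapse of such blocks in the image
          therefore loses no mass.\<close>
        have "(\<Sum>C\<in>(\<lambda>B. B \<inter> A i) ` P. norm (\<nu> C)) = (\<Sum>B\<in>P. norm (\<nu> (B \<inter> A i)))"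
        proof (subst sum.reindex_nontrivial)
          show "finite P" using P by auto
          fix B C assume *: "B \<in> P" "C \<in> P" "B \<noteq> C" "B \<inter> A i = C \<inter> A i"
          then have "B \<inter> C = {}" using P by (auto simp: disjoint_def)
          with * have "B \<inter> A i = {}" by auto
          then show "norm (\<nu> (B \<inter> A i)) = 0" using \<nu> by simp
        qed (simp add: o_def)
        moreover have "disjoint ((\<lambda>B. B \<inter> A i) ` P)"
          using P by (intro disjointI) (auto dest: disjointD)
        then have "(\<lambda>B. B \<inter> A i) ` P \<in> ?S (A i)"
          using P A by auto
        then have "ennreal (\<Sum>C\<in>(\<lambda>B. B \<inter> A i) ` P. norm (\<nu> C)) \<le> ?F (A i)"
          by (rule SUP_upper)
        ultimately show ?thesis by simp
      qed
      have "ennreal (\<Sum>B\<in>P. norm (\<nu> B)) \<le> (\<Sum>B\<in>P. (\<Sum>i. ennreal (norm (\<nu> (B \<inter> A i)))))"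
      proof (subst sum_ennreal[symmetric], simp, rule sum_mono)
        fix B assume "B \<in> P"
        then have s: "(\<lambda>i. \<nu> (B \<inter> A i)) sums \<nu> B"
          using P A by (intro bounded_additive_sums_Int[OF \<nu>]) auto
        \<comment> \<open>The triangle inequality for the infinite series comes from that for
          partial sums, by continuity of the norm.\<close>
        have "(\<lambda>n. ennreal (norm (\<Sum>i<n. \<nu> (B \<inter> A i)))) \<longlonglongrightarrow> ennreal (norm (\<nu> B))"
          using s by (intro tendsto_ennrealI tendsto_norm) (simp add: sums_def)
        moreover have "ennreal (norm (\<Sum>i<n. \<nu> (B \<inter> A i))) \<le> (\<Sum>i. ennreal (norm (\<nu> (B \<inter> A i))))" for n
        proof -
          have "ennreal (norm (\<Sum>i<n. \<nu> (B \<inter> A i))) \<le> (\<Sum>i<n. ennreal (norm (\<nu> (B \<inter> A i))))"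
            by (simp add: norm_sum sum_ennreal ennreal_leI)
          also have "\<dots> \<le> (\<Sum>i. ennreal (norm (\<nu> (B \<inter> A i))))" by (rule sum_le_suminf) auto
          finally show ?thesis .
        qed
        ultimately show "ennreal (norm (\<nu> B)) \<le> (\<Sum>i. ennreal (norm (\<nu> (B \<inter> A i))))"
          by (intro LIMSEQ_le_const2) blast+
      qed
      also have "\<dots> = (\<Sum>i. \<Sum>B\<in>P. ennreal (norm (\<nu> (B \<inter> A i))))"
        by (rule suminf_sum[symmetric]) auto
      also have "\<dots> \<le> (\<Sum>i. ?F (A i))"
        using piece by (intro suminf_le) (auto simp: sum_ennreal)
      finally show "ennreal (\<Sum>B\<in>P. norm (\<nu> B)) \<le> (\<Sum>i. ?F (A i))" .
    qed
  qed
  then show ?thesis by (simp add: total_variation_def)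
qed

section \<open>Finiteness on bounded sets and the Jordan decomposition\<close>

lemma emeasure_jordan_pos_upper:
  assumes "bounded_additive \<sigma>" "A \<in> sets Rplus" "B \<in> bounded_borel" "B \<subseteq> A"
  shows "ennreal (\<sigma> B) \<le> emeasure (jordan_pos \<sigma>) A"
  unfolding emeasure_jordan_pos[OF assms(1,2)] using assms by (intro SUP_upper) auto

text \<open>
  If the positive variation of a bounded set were infinite, the set could be halved repeatedly, each
  time splitting off a piece of mass at least one while the rest keeps infinite positive variation.
\<close>

lemma emeasure_jordan_pos_finite:
  fixes \<sigma> :: "real set \<Rightarrow> real"
  assumes \<sigma>: "bounded_additive \<sigma>" and A: "A \<in> bounded_borel"
  shows "emeasure (jordan_pos \<sigma>) A < \<infinity>"
proof (rule ccontr)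
  let ?F = "emeasure (jordan_pos \<sigma>)"
  assume "\<not> ?F A < \<infinity>"
  then have inf: "?F A = \<infinity>" by (simp add: less_top[symmetric])
  define Q where "Q X \<longleftrightarrow> X \<in> bounded_borel \<and> X \<subseteq> A \<and> ?F X = \<infinity>" for X
  have step: "\<exists>Y. Q Y \<and> Y \<subseteq> X \<and> \<bar>\<sigma> (X - Y)\<bar> \<ge> 1" if X: "Q X" for X
  proof -
    have Xb: "X \<in> bounded_borel" using X by (simp add: Q_def)
    \<comment> \<open>The excess over \<open>\<bar>\<sigma> X\<bar> + 1\<close> makes both
      \<open>\<sigma> B\<close> and \<open>\<sigma> (X - B) = \<sigma> X - \<sigma> B\<close> at
      least 1 in modulus. So whichever half keeps the infinite variation, the discarded half has
      mass at least 1.\<close>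
    have "ennreal (\<bar>\<sigma> X\<bar> + 1) < (SUP B \<in> {B \<in> bounded_borel. B \<subseteq> X}. ennreal (\<sigma> B))"
      using X \<sigma> by (subst emeasure_jordan_pos[symmetric]) (auto simp: Q_def)
    then obtain B where B: "B \<in> bounded_borel" "B \<subseteq> X" "ennreal (\<bar>\<sigma> X\<bar> + 1) < ennreal (\<sigma> B)"
      by (auto simp: less_SUP_iff)
    have B3: "\<bar>\<sigma> X\<bar> + 1 < \<sigma> B" using B(3) by (subst (asm) ennreal_less_iff) simp_all
    have d: "\<sigma> (X - B) = \<sigma> X - \<sigma> B"
      using B Xb \<sigma> by (intro bounded_additive_Diff) auto
    have "?F X = ?F B + ?F (X - B)"
      using B Xb by (subst plus_emeasure) (auto simp: Un_absorb1)
    with X have "?F B = \<infinity> \<or> ?F (X - B) = \<infinity>" by (auto simp: Q_def)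
    then show ?thesis
    proof
      assume "?F B = \<infinity>"
      then show ?thesis using B X B3 d by (intro exI[of _ B]) (auto simp: Q_def)
    next
      assume *: "?F (X - B) = \<infinity>"
      have "X - (X - B) = B" using B by auto
      with * show ?thesis using B X B3 by (intro exI[of _ "X - B"]) (auto simp: Q_def)
    qed
  qed
  have "Q A" using inf A by (simp add: Q_def)
  then have "\<exists>h. \<forall>n. Q (h n) \<and> h (Suc n) \<subseteq> h n \<and> \<bar>\<sigma> (h n - h (Suc n))\<bar> \<ge> 1"
    by (intro dependent_nat_choice[of "\<lambda>_. Q" "\<lambda>_ X Y. Y \<subseteq> X \<and> \<bar>\<sigma> (X - Y)\<bar> \<ge> 1"]
        exI[of _ A] step)
  then obtain h where "\<forall>n. Q (h n) \<and> h (Suc n) \<subseteq> h n \<and> \<bar>\<sigma> (h n - h (Suc n))\<bar> \<ge> 1"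
    by (rule exE)
  then have h: "Q (h n)" "h (Suc n) \<subseteq> h n" "\<bar>\<sigma> (h n - h (Suc n))\<bar> \<ge> 1" for n by simp_all
  define C where "C n = h n - h (Suc n)" for n
  have dec: "h n \<subseteq> h m" if "m \<le> n" for m n
    by (rule lift_Suc_antimono_le[of h, OF h(2) that])
  have "disjoint_family C"
  proof -
    have lt: "C m \<inter> C n = {}" if "m < n" for m n
      using dec[of "Suc m" n] that by (auto simp: C_def)
    show ?thesis
      unfolding disjoint_family_on_def
    proof (intro ballI impI)
      fix m n :: nat assume "m \<noteq> n"
      then consider "m < n" | "n < m" by linarith
      then show "C m \<inter> C n = {}" using lt[of m n] lt[of n m] by cases auto
    qed
  qed
  moreover have C: "range C \<subseteq> bounded_borel"
    using h(1) by (auto simp: C_def Q_def)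
  \<comment> \<open>All discarded pieces lie in the bounded set \<open>A\<close>, so countable
    additivity applies to them; a convergent series cannot have all its terms of modulus at least
    1.\<close>
  moreover have "(\<Union>i. C i) \<in> bounded_borel"
  proof (rule bounded_borel_subset[OF A])
    show "(\<Union>i. C i) \<in> sets Rplus" using C by (intro sets.countable_UN) auto
    show "(\<Union>i. C i) \<subseteq> A" using h(1) by (auto simp: C_def Q_def)
  qed
  ultimately have "(\<lambda>i. \<sigma> (C i)) sums \<sigma> (\<Union>i. C i)"
    using \<sigma>[unfolded bounded_additive_def, rule_format, of C] by simp
  then have "(\<lambda>i. \<sigma> (C i)) \<longlonglongrightarrow> 0" by (simp add: sums_summable summable_LIMSEQ_zero)
  then obtain i where "\<bar>\<sigma> (C i)\<bar> < 1"
    using LIMSEQ_D[of "\<lambda>i. \<sigma> (C i)" 0 1] by auto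
  then show False using h(3)[of i] by (simp add: C_def)
qed

lemma bounded_additive_uminus:
  assumes "bounded_additive \<sigma>"
  shows "bounded_additive (\<lambda>A. - \<sigma> A)"
  by (rule bounded_additive_bounded_linear) (rule assms bounded_linear_minus[OF bounded_linear_ident])+

text \<open>One inequality suffices: replacing \<sigma> by its negative exchanges the positive and
  the negative part, which turns the inequality \<open>le\<close> into its converse.\<close>

lemma jordan_decomposition:
  fixes \<sigma> :: "real set \<Rightarrow> real"
  assumes \<sigma>: "bounded_additive \<sigma>" and A: "A \<in> bounded_borel"
  shows "\<sigma> A = measure (jordan_pos \<sigma>) A - measure (jordan_neg \<sigma>) A"
proof -
  have \<sigma>': "bounded_additive (\<lambda>A. - \<sigma> A)" by (rule bounded_additive_uminus[OF \<sigma>])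
  have le: "\<sigma> A \<le> measure (jordan_pos \<sigma>) A - measure (jordan_pos (\<lambda>A. - \<sigma> A)) A"
    if \<sigma>: "bounded_additive \<sigma>" for \<sigma> :: "real set \<Rightarrow> real"
  proof -
    have \<sigma>': "bounded_additive (\<lambda>A. - \<sigma> A)" by (rule bounded_additive_uminus[OF \<sigma>])
    have fin: "emeasure (jordan_pos \<sigma>) A < \<infinity>" by (rule emeasure_jordan_pos_finite[OF \<sigma> A])
    \<comment> \<open>Here \<open>- \<sigma> B = \<sigma> (A - B) - \<sigma> A\<close>, so a
      competitor for the negative part is the complement of one for the positive part. Finiteness
      permits the subtraction.\<close>
    have le: "- \<sigma> B \<le> measure (jordan_pos \<sigma>) A - \<sigma> A" if B: "B \<in> bounded_borel" "B \<subseteq> A" for B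
    proof -
      have "ennreal (\<sigma> (A - B)) \<le> emeasure (jordan_pos \<sigma>) A"
        using A B \<sigma> by (intro emeasure_jordan_pos_upper) auto
      then have "\<sigma> (A - B) \<le> measure (jordan_pos \<sigma>) A"
        using fin by (simp add: emeasure_eq_ennreal_measure)
      then show ?thesis using bounded_additive_Diff[OF \<sigma> A, of B] B by auto
    qed
    have nn: "0 \<le> measure (jordan_pos \<sigma>) A - \<sigma> A"
      using le[of "{}"] \<sigma> by simp
    have "emeasure (jordan_pos (\<lambda>A. - \<sigma> A)) A \<le> ennreal (measure (jordan_pos \<sigma>) A - \<sigma> A)"
      using A by (subst emeasure_jordan_pos[OF \<sigma>']) (auto intro!: SUP_least ennreal_leI le)
    then have "measure (jordan_pos (\<lambda>A. - \<sigma> A)) A \<le> measure (jordan_pos \<sigma>) A - \<sigma> A"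
      using nn unfolding measure_def[of "jordan_pos (\<lambda>A. - \<sigma> A)"] by (simp add: enn2real_leI)
    then show ?thesis by simp
  qed
  show ?thesis
    using le[OF \<sigma>] le[OF \<sigma>'] by (simp add: jordan_neg_def)
qed

section \<open>Representation by a density\<close>

lemma bounded_additive_Re: "bounded_additive \<nu> \<Longrightarrow> bounded_additive (\<lambda>A. Re (\<nu> A))"
  by (rule bounded_additive_bounded_linear[OF _ bounded_linear_Re])

lemma bounded_additive_Im: "bounded_additive \<nu> \<Longrightarrow> bounded_additive (\<lambda>A. Im (\<nu> A))"
  by (rule bounded_additive_bounded_linear[OF _ bounded_linear_Im])

lemma sum_emeasure_disjoint_le:
  assumes "finite P" "disjoint P" "P \<subseteq> sets M" "\<Union>P \<subseteq> A" "A \<in> sets M"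
  shows "(\<Sum>B\<in>P. emeasure M B) \<le> emeasure M A"
proof -
  have "(\<Sum>B\<in>P. emeasure M B) = emeasure M (\<Union>B\<in>P. B)"
    using assms by (intro sum_emeasure) (auto simp: disjoint_family_on_def disjoint_def)
  also have "\<dots> \<le> emeasure M A" using assms by (intro emeasure_mono) simp_all
  finally show ?thesis .
qed

text \<open>A measure that dominates \<nu> on each bounded set dominates every sum over a disjoint
  family. The total variation is thus the least such measure, and this minimality is how it is
  bounded for represented measures.\<close>

lemma total_variation_le:
  assumes "bounded_additive \<nu>" "sets \<rho> = sets Rplus"
    and bound: "\<And>B. B \<in> bounded_borel \<Longrightarrow> ennreal (norm (\<nu> B)) \<le> emeasure \<rho> B"
  shows "total_variation \<nu> \<le> \<rho>"
proof (subst le_measure)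
  show "sets (total_variation \<nu>) = sets \<rho>" using assms(2) by simp
  show "\<forall>A\<in>sets (total_variation \<nu>). emeasure (total_variation \<nu>) A \<le> emeasure \<rho> A"
  proof
    fix A assume A: "A \<in> sets (total_variation \<nu>)"
    then show "emeasure (total_variation \<nu>) A \<le> emeasure \<rho> A"
      unfolding sets_total_variation emeasure_total_variation[OF assms(1) A[unfolded sets_total_variation]]
    proof (intro SUP_least)
      fix P assume P: "P \<in> {P. finite P \<and> disjoint P \<and> P \<subseteq> bounded_borel \<and> \<Union>P \<subseteq> A}"
      have "ennreal (\<Sum>B\<in>P. norm (\<nu> B)) = (\<Sum>B\<in>P. ennreal (norm (\<nu> B)))" by (simp add: sum_ennreal)
      also have "\<dots> \<le> (\<Sum>B\<in>P. emeasure \<rho> B)" using P by (intro sum_mono bound) blast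
      also have "\<dots> \<le> emeasure \<rho> A"
      proof (rule sum_emeasure_disjoint_le)
        show "P \<subseteq> sets \<rho>" unfolding assms(2) using P bounded_borel_simps(3) by blast
        show "A \<in> sets \<rho>" using A assms(2) by simp
      qed (use P in simp_all)
      finally show "ennreal (\<Sum>B\<in>P. norm (\<nu> B)) \<le> emeasure \<rho> A" .
    qed
  qed
qed

lemma jordan_pos_le_total_variation:
  fixes \<sigma> :: "real set \<Rightarrow> real"
  assumes "bounded_additive \<nu>" "bounded_additive \<sigma>" "\<And>A. \<sigma> A \<le> norm (\<nu> A)"
  shows "jordan_pos \<sigma> \<le> total_variation \<nu>"
proof (subst le_measure)
  show "\<forall>A\<in>sets (jordan_pos \<sigma>). emeasure (jordan_pos \<sigma>) A \<le> emeasure (total_variation \<nu>) A"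
  proof
    fix A assume "A \<in> sets (jordan_pos \<sigma>)"
    then have A: "A \<in> sets Rplus" by simp
    show "emeasure (jordan_pos \<sigma>) A \<le> emeasure (total_variation \<nu>) A"
      unfolding emeasure_jordan_pos[OF assms(2) A]
    proof (rule SUP_least)
      fix B assume B: "B \<in> {B \<in> bounded_borel. B \<subseteq> A}"
      \<comment> \<open>The one-element family {B} competes in the supremum that defines the
        variation.\<close>
      have "ennreal (\<sigma> B) \<le> ennreal (\<Sum>C\<in>{B}. norm (\<nu> C))"
        using assms(3) by (simp add: ennreal_leI)
      also have "\<dots> \<le> emeasure (total_variation \<nu>) A"
        unfolding emeasure_total_variation[OF assms(1) A] using B by (intro SUP_upper) simp
      finally show "ennreal (\<sigma> B) \<le> emeasure (total_variation \<nu>) A" .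
    qed
  qed
qed simp

lemma jordan_parts_le_total_variation:
  assumes "bounded_additive \<nu>"
  shows "jordan_pos (\<lambda>A. Re (\<nu> A)) \<le> total_variation \<nu>"
    and "jordan_neg (\<lambda>A. Re (\<nu> A)) \<le> total_variation \<nu>"
    and "jordan_pos (\<lambda>A. Im (\<nu> A)) \<le> total_variation \<nu>"
    and "jordan_neg (\<lambda>A. Im (\<nu> A)) \<le> total_variation \<nu>"
  unfolding jordan_neg_def
  using abs_Re_le_cmod[of "\<nu> _"] abs_Im_le_cmod[of "\<nu> _"]
  by (auto intro!: jordan_pos_le_total_variation assms bounded_additive_Re bounded_additive_Im
      bounded_additive_uminus intro: order_trans[OF abs_ge_self] order_trans[OF abs_ge_minus_self])

lemma integrable_le_measure:
  fixes f :: "'a \<Rightarrow> 'b::{banach, second_countable_topology}"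
  assumes "M \<le> N" "sets M = sets N" "integrable N f"
  shows "integrable M f"
  using assms(3) nn_integral_mono_measure[OF assms(2,1), of "\<lambda>x. ennreal (norm (f x))"]
  by (auto simp: integrable_iff_bounded measurable_cong_sets[OF assms(2)] intro: le_less_trans)

lemma cintegral_cong:
  assumes "\<And>t. t \<ge> 0 \<Longrightarrow> h t = k t"
  shows "cintegral \<nu> h = cintegral \<nu> k"
  unfolding cintegral_def
  by (intro arg_cong2[of _ _ _ _ "(+)"] arg_cong2[of _ _ _ _ "(-)"] arg_cong2[of _ _ _ _ "(*)"]
      Bochner_Integration.integral_cong refl) (simp_all add: assms)

text \<open>
  The point of the auxiliary space \<open>\<Omega>\<close> is that convolutions are represented on product spaces: there
  the density is a product, whereas it need not be a function of the sum of the two variables.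
\<close>

definition represents ::
  "'a measure \<Rightarrow> ('a \<Rightarrow> real) \<Rightarrow> ('a \<Rightarrow> complex) \<Rightarrow> (real set \<Rightarrow> complex) \<Rightarrow> bool" where
  "represents \<Omega> \<phi> f \<nu> \<longleftrightarrow> \<phi> \<in> \<Omega> \<rightarrow>\<^sub>M Rplus \<and> f \<in> borel_measurable \<Omega> \<and>
     (\<forall>A. A \<notin> bounded_borel \<longrightarrow> \<nu> A = 0) \<and>
     (\<forall>A\<in>bounded_borel. integrable \<Omega> (\<lambda>x. indicat_real A (\<phi> x) *\<^sub>R f x) \<and>
        \<nu> A = (\<integral>x. indicat_real A (\<phi> x) *\<^sub>R f x \<partial>\<Omega>))"

lemma representsD:
  assumes "represents \<Omega> \<phi> f \<nu>"
  shows "\<phi> \<in> \<Omega> \<rightarrow>\<^sub>M Rplus" "f \<in> borel_measurable \<Omega>"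
    and "A \<in> bounded_borel \<Longrightarrow> integrable \<Omega> (\<lambda>x. indicat_real A (\<phi> x) *\<^sub>R f x)"
    and "A \<in> bounded_borel \<Longrightarrow> \<nu> A = (\<integral>x. indicat_real A (\<phi> x) *\<^sub>R f x \<partial>\<Omega>)"
  using assms unfolding represents_def by blast+

lemma represents_lf_measures:
  assumes rep: "represents \<Omega> \<phi> f \<nu>"
  shows "\<nu> \<in> lf_measures"
  unfolding lf_measures_iff bounded_additive_def
proof (intro conjI allI impI)
  show "\<nu> A = 0" if "A \<notin> bounded_borel" for A
    using rep that unfolding represents_def by blast
  note [measurable] = representsD(1,2)[OF rep]
  fix A :: "nat \<Rightarrow> real set"
  assume A: "range A \<subseteq> bounded_borel" "disjoint_family A" "(\<Union>i. A i) \<in> bounded_borel"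
  let ?U = "\<Union>i. A i"
  have Ab: "A i \<in> bounded_borel" for i using A by blast
  have [measurable]: "A i \<in> sets Rplus" "?U \<in> sets Rplus" for i using Ab A(3) by simp_all
  have s: "(\<lambda>i. indicat_real (A i) t) sums indicat_real ?U t" for t
    using A(2) by (intro indicator_sums) (auto simp: disjoint_family_on_def)
  have "(\<lambda>n. \<integral>x. (\<Sum>i<n. indicat_real (A i) (\<phi> x) *\<^sub>R f x) \<partial>\<Omega>) \<longlonglongrightarrow>
      (\<integral>x. indicat_real ?U (\<phi> x) *\<^sub>R f x \<partial>\<Omega>)"
  \<comment> \<open>By disjointness each partial sum of indicators is at most the indicator of the
    union. The union is bounded, so the integrand over it is an integrable majorant.\<close>
  proof (rule integral_dominated_convergence[where w = "\<lambda>x. norm (indicat_real ?U (\<phi> x) *\<^sub>R f x)"])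
    show "integrable \<Omega> (\<lambda>x. norm (indicat_real ?U (\<phi> x) *\<^sub>R f x))"
      by (intro integrable_norm representsD(3)[OF rep] A)
    show "AE x in \<Omega>. (\<lambda>n. \<Sum>i<n. indicat_real (A i) (\<phi> x) *\<^sub>R f x) \<longlonglongrightarrow> indicat_real ?U (\<phi> x) *\<^sub>R f x"
      using s unfolding sums_def scaleR_left.sum[symmetric] by (intro AE_I2 tendsto_intros) blast
    show "AE x in \<Omega>. norm (\<Sum>i<n. indicat_real (A i) (\<phi> x) *\<^sub>R f x) \<le> norm (indicat_real ?U (\<phi> x) *\<^sub>R f x)" for n
    proof (rule AE_I2)
      fix x
      have "(\<Sum>i<n. indicat_real (A i) (\<phi> x)) \<le> indicat_real ?U (\<phi> x)"
        using s[of "\<phi> x"] by (intro sum_le_suminf[THEN order_trans]) (auto simp: sums_iff)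
      then show "norm (\<Sum>i<n. indicat_real (A i) (\<phi> x) *\<^sub>R f x) \<le> norm (indicat_real ?U (\<phi> x) *\<^sub>R f x)"
        unfolding scaleR_left.sum[symmetric] norm_scaleR
        by (intro mult_right_mono) (simp_all add: sum_nonneg)
    qed
  qed measurable
  then show "(\<lambda>i. \<nu> (A i)) sums \<nu> (\<Union>i. A i)"
    unfolding sums_def representsD(4)[OF rep Ab] representsD(4)[OF rep A(3)]
    by (subst (asm) Bochner_Integration.integral_sum) (rule representsD(3)[OF rep Ab])
qed

text \<open>The right-hand side is the image under \<open>\<phi>\<close> of the measure with density
  \<open>norm (f x)\<close>. Equality cannot be expected, since values of \<open>f\<close> over the
  same point of the half line may cancel.\<close>

lemma represents_total_variation_le:
  assumes rep: "represents \<Omega> \<phi> f \<nu>"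
  shows "total_variation \<nu> \<le> distr (density \<Omega> (\<lambda>x. ennreal (norm (f x)))) Rplus \<phi>"
proof (rule total_variation_le)
  note [measurable] = representsD(1,2)[OF rep]
  show "bounded_additive \<nu>" using represents_lf_measures[OF rep] by (simp add: lf_measures_iff)
  fix B assume B: "B \<in> bounded_borel"
  then have [measurable]: "B \<in> sets Rplus" by simp
  have "ennreal (norm (\<nu> B)) \<le> (\<integral>\<^sup>+x. ennreal (norm (indicat_real B (\<phi> x) *\<^sub>R f x)) \<partial>\<Omega>)"
    unfolding representsD(4)[OF rep B]
    by (rule integral_norm_bound_ennreal[OF representsD(3)[OF rep B]])
  also have "\<dots> = (\<integral>\<^sup>+x. ennreal (norm (f x)) * indicator B (\<phi> x) \<partial>\<Omega>)"
    by (intro nn_integral_cong) (auto split: split_indicator)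
  also have "\<dots> = emeasure (distr (density \<Omega> (\<lambda>x. ennreal (norm (f x)))) Rplus \<phi>) B"
    by (simp add: nn_integral_indicator[symmetric] nn_integral_distr nn_integral_density
        del: nn_integral_indicator)
  finally show "ennreal (norm (\<nu> B)) \<le> emeasure (distr (density \<Omega> (\<lambda>x. ennreal (norm (f x)))) Rplus \<phi>) B" .
qed simp

lemma represents_wnorm_le:
  assumes rep: "represents \<Omega> \<phi> f \<nu>" and w [measurable]: "w \<in> borel_measurable Rplus"
  shows "wnorm w \<nu> \<le> (\<integral>\<^sup>+x. ennreal (norm (f x)) * ennreal (w (\<phi> x)) \<partial>\<Omega>)"
proof -
  note [measurable] = representsD(1,2)[OF rep]
  have "wnorm w \<nu> \<le> (\<integral>\<^sup>+t. ennreal (w t) \<partial>distr (density \<Omega> (\<lambda>x. ennreal (norm (f x)))) Rplus \<phi>)"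
    unfolding wnorm_def by (intro nn_integral_mono_measure represents_total_variation_le rep) simp
  also have "\<dots> = (\<integral>\<^sup>+x. ennreal (norm (f x)) * ennreal (w (\<phi> x)) \<partial>\<Omega>)"
    by (simp add: nn_integral_distr nn_integral_density)
  finally show ?thesis .
qed

text \<open>The integral does not depend on the representation. All four Jordan parts lie below the
  image \<rho> of the measure with density \<open>norm (f x)\<close>, so the single integrability
  hypothesis controls four integrals at once, and induction over the \<rho>-integrable functions
  compares both sides.\<close>

lemma cintegral_represents:
  assumes rep: "represents \<Omega> \<phi> f \<nu>"
    and h [measurable]: "h \<in> borel_measurable Rplus"
    and int: "integrable \<Omega> (\<lambda>x. h (\<phi> x) * f x)"
  shows "cintegral \<nu> h = (\<integral>x. h (\<phi> x) * f x \<partial>\<Omega>)"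
proof -
  note [measurable] = representsD(1,2)[OF rep]
  have add: "bounded_additive \<nu>" using represents_lf_measures[OF rep] by (simp add: lf_measures_iff)
  define \<rho> where "\<rho> = distr (density \<Omega> (\<lambda>x. ennreal (norm (f x)))) Rplus \<phi>"
  have sets_\<rho> [simp, measurable_cong]: "sets \<rho> = sets Rplus" and space_\<rho> [simp]: "space \<rho> = {0..}"
    by (simp_all add: \<rho>_def)
  have \<phi>_nonneg: "\<phi> x \<ge> 0" if "x \<in> space \<Omega>" for x
    using measurable_space[OF representsD(1)[OF rep] that] by simp
  have int_iff: "integrable \<rho> k \<longleftrightarrow> integrable \<Omega> (\<lambda>x. k (\<phi> x) * f x)"
    if [measurable]: "k \<in> borel_measurable Rplus" for k :: "real \<Rightarrow> complex"
    unfolding \<rho>_def integrable_iff_bounded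
    by (simp add: nn_integral_distr nn_integral_density norm_mult ennreal_mult' mult.commute)
  define Rp Rn Ip In where
    parts: "Rp = jordan_pos (\<lambda>A. Re (\<nu> A))" "Rn = jordan_neg (\<lambda>A. Re (\<nu> A))"
           "Ip = jordan_pos (\<lambda>A. Im (\<nu> A))" "In = jordan_neg (\<lambda>A. Im (\<nu> A))"
  have part_le: "Rp \<le> \<rho>" "Rn \<le> \<rho>" "Ip \<le> \<rho>" "In \<le> \<rho>"
    unfolding parts \<rho>_def
    by (auto intro: order_trans[OF jordan_parts_le_total_variation(1)[OF add]]
        order_trans[OF jordan_parts_le_total_variation(2)[OF add]]
        order_trans[OF jordan_parts_le_total_variation(3)[OF add]]
        order_trans[OF jordan_parts_le_total_variation(4)[OF add]]
        represents_total_variation_le[OF rep])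
  have part_sets [simp, measurable_cong]:
    "sets Rp = sets Rplus" "sets Rn = sets Rplus" "sets Ip = sets Rplus" "sets In = sets Rplus"
    by (simp_all add: parts)
  have part_space [simp]: "space Rp = {0..}" "space Rn = {0..}" "space Ip = {0..}" "space In = {0..}"
    by (simp_all add: parts)
  have part_int: "integrable M k" if "integrable \<rho> k" "M \<in> {Rp, Rn, Ip, In}"
    for M and k :: "real \<Rightarrow> complex"
    using that part_le by (auto intro: integrable_le_measure[of _ \<rho>])
  have cint: "cintegral \<nu> k = (integral\<^sup>L Rp k - integral\<^sup>L Rn k) + \<i> * (integral\<^sup>L Ip k - integral\<^sup>L In k)" for k
    by (simp add: cintegral_def parts)
  have "integrable \<rho> h" using int by (simp add: int_iff)
  then show ?thesis
  proof (induction rule: integrable_induct)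
    case (base A c)
    then have [measurable]: "A \<in> sets Rplus" by simp
    \<comment> \<open>\<open>A\<close> may be unbounded, and then \<open>\<nu> A\<close> is only the
      default value 0. Both sides are therefore computed on bounded truncations, where they equal
      \<open>\<nu> (?A n)\<close>, and passed to the limit.\<close>
    let ?A = "\<lambda>n::nat. A \<inter> {0..real n}"
    have [measurable]: "{0..real n} \<in> sets Rplus" for n by (rule bounded_borel_simps(3)) simp
    have A: "?A n \<in> bounded_borel" for n by (rule bounded_borel_Int_Diff(2)) simp_all
    have UA: "(\<Union>n. ?A n) = A"
    proof -
      have "\<exists>n. x \<in> {0..real n}" if "x \<in> A" for x
        using real_arch_simple[of x] that sets.sets_into_space[OF \<open>A \<in> sets Rplus\<close>] by auto
      then show ?thesis by blast
    qed
    have M: "(\<lambda>n. measure M (?A n)) \<longlonglongrightarrow> measure M A" if "M \<in> {Rp, Rn, Ip, In}" for M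
    proof -
      have "emeasure M A \<le> emeasure \<rho> A"
        using that part_le by (auto intro: le_measureD3)
      then have "emeasure M (\<Union>n. ?A n) \<noteq> \<infinity>" unfolding UA using base(2) by (auto simp: top_unique)
      then have "(\<lambda>n. measure M (?A n)) \<longlonglongrightarrow> measure M (\<Union>n. ?A n)"
        using that by (intro Lim_measure_incseq) (auto simp: incseq_def)
      then show ?thesis by (simp only: UA)
    qed
    have intA: "integrable \<rho> (\<lambda>t. indicator A t *\<^sub>R (1::complex))" using base by simp
    have intA': "integrable \<Omega> (\<lambda>x. indicat_real A (\<phi> x) *\<^sub>R f x)"
      using intA by (subst (asm) int_iff) simp_all
    have "(\<lambda>n. \<nu> (?A n)) \<longlonglongrightarrow>
        complex_of_real (measure Rp A) - measure Rn A + \<i> * (complex_of_real (measure Ip A) - measure In A)"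
    proof -
      have "\<nu> B = complex_of_real (measure Rp B) - measure Rn B + \<i> * (complex_of_real (measure Ip B) - measure In B)"
        if "B \<in> bounded_borel" for B
        using jordan_decomposition[OF bounded_additive_Re[OF add] that]
          jordan_decomposition[OF bounded_additive_Im[OF add] that]
        by (simp add: complex_eq_iff parts)
      then show ?thesis using A by (simp only:) (intro tendsto_intros M; simp)
    qed
    moreover have "(\<lambda>n. \<nu> (?A n)) \<longlonglongrightarrow> (\<integral>x. indicat_real A (\<phi> x) *\<^sub>R f x \<partial>\<Omega>)"
      unfolding representsD(4)[OF rep A]
    proof (rule integral_dominated_convergence[where w = "\<lambda>x. norm (indicat_real A (\<phi> x) *\<^sub>R f x)"])
      show "integrable \<Omega> (\<lambda>x. norm (indicat_real A (\<phi> x) *\<^sub>R f x))" using intA' by (rule integrable_norm)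
      show "AE x in \<Omega>. (\<lambda>n. indicat_real (?A n) (\<phi> x) *\<^sub>R f x) \<longlonglongrightarrow> indicat_real A (\<phi> x) *\<^sub>R f x"
      proof (intro AE_I2 tendsto_intros)
        fix x
        have "(\<lambda>n. indicat_real (?A n) (\<phi> x)) \<longlonglongrightarrow> indicat_real (\<Union>n. ?A n) (\<phi> x)"
          by (rule LIMSEQ_indicator_incseq) (auto simp: incseq_def)
        then show "(\<lambda>n. indicat_real (?A n) (\<phi> x)) \<longlonglongrightarrow> indicat_real A (\<phi> x)" by (simp only: UA)
      qed
    qed (auto split: split_indicator)
    ultimately have val: "(\<integral>x. indicat_real A (\<phi> x) *\<^sub>R f x \<partial>\<Omega>) =
        complex_of_real (measure Rp A) - measure Rn A + \<i> * (complex_of_real (measure Ip A) - measure In A)"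
      by (rule LIMSEQ_unique[rotated])
    have pull: "(\<integral>x. (indicat_real A (\<phi> x) *\<^sub>R c) * f x \<partial>\<Omega>) = c * (\<integral>x. indicat_real A (\<phi> x) *\<^sub>R f x \<partial>\<Omega>)"
      by (subst integral_mult_right_zero[symmetric], intro Bochner_Integration.integral_cong)
        (simp_all add: scaleR_conv_of_real)
    have part: "integral\<^sup>L M (\<lambda>t. indicat_real A t *\<^sub>R c) = complex_of_real (measure M A) * c"
      if "M \<in> {Rp, Rn, Ip, In}" for M
    proof -
      have "emeasure M A \<le> emeasure \<rho> A"
        using that part_le by (auto intro: le_measureD3)
      then have "emeasure M A < \<infinity>" using base(2) by (rule le_less_trans)
      moreover have "A \<in> sets M" using that by auto
      ultimately show ?thesis by (simp add: scaleR_conv_of_real integral_indicator)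
    qed
    show ?case unfolding pull val cint by (simp add: part algebra_simps)
  next
    case (add k l)
    have [measurable]: "k \<in> borel_measurable Rplus" "l \<in> borel_measurable Rplus"
      using borel_measurable_integrable[OF add(1)] borel_measurable_integrable[OF add(2)]
      by (simp_all add: measurable_cong_sets[OF sets_\<rho> refl])
    have "(\<integral>x. (k (\<phi> x) + l (\<phi> x)) * f x \<partial>\<Omega>) = (\<integral>x. k (\<phi> x) * f x \<partial>\<Omega>) + (\<integral>x. l (\<phi> x) * f x \<partial>\<Omega>)"
      using add(1,2) by (simp add: int_iff distrib_right)
    also have "\<dots> = cintegral \<nu> k + cintegral \<nu> l" by (simp add: add)
    also have "\<dots> = cintegral \<nu> (\<lambda>t. k t + l t)"
      unfolding cint using part_int[OF add(1)] part_int[OF add(2)] by (simp add: algebra_simps)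
    finally show ?case by simp
  next
    case (lim k s)
    have [measurable]: "k \<in> borel_measurable Rplus" "s i \<in> borel_measurable Rplus" for i
      using borel_measurable_integrable[OF lim(4)] borel_measurable_integrable[OF lim(1)]
      by (simp_all add: measurable_cong_sets[OF sets_\<rho> refl])
    have L: "(\<lambda>i. integral\<^sup>L M (s i)) \<longlonglongrightarrow> integral\<^sup>L M k" if M: "M \<in> {Rp, Rn, Ip, In}" for M
    proof (rule integral_dominated_convergence[where w = "\<lambda>x. 2 * norm (k x)"])
      have [measurable_cong]: "sets M = sets Rplus" and [simp]: "space M = {0..}" using M by auto
      show "integrable M (\<lambda>x. 2 * norm (k x))" using part_int[OF lim(4) M] by simp
      show "k \<in> borel_measurable M" "s i \<in> borel_measurable M" for i by measurable
      show "AE x in M. (\<lambda>i. s i x) \<longlonglongrightarrow> k x" "AE x in M. norm (s i x) \<le> 2 * norm (k x)" for i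
        using lim(2,3) by (auto intro!: AE_I2)
    qed
    have "(\<lambda>i. cintegral \<nu> (s i)) \<longlonglongrightarrow> cintegral \<nu> k"
      unfolding cint by (intro tendsto_intros L) simp_all
    moreover have "(\<lambda>i. cintegral \<nu> (s i)) \<longlonglongrightarrow> (\<integral>x. k (\<phi> x) * f x \<partial>\<Omega>)"
      unfolding lim(5)
    proof (rule integral_dominated_convergence[where w = "\<lambda>x. 2 * norm (k (\<phi> x) * f x)"])
      show "integrable \<Omega> (\<lambda>x. 2 * norm (k (\<phi> x) * f x))" using lim(4) by (simp add: int_iff)
      show "AE x in \<Omega>. (\<lambda>i. s i (\<phi> x) * f x) \<longlonglongrightarrow> k (\<phi> x) * f x"
        using lim(2) \<phi>_nonneg by (intro AE_I2 tendsto_intros) simp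
      show "AE x in \<Omega>. norm (s i (\<phi> x) * f x) \<le> 2 * norm (k (\<phi> x) * f x)" for i
      proof (rule AE_I2)
        fix x assume "x \<in> space \<Omega>"
        then have "norm (s i (\<phi> x)) * norm (f x) \<le> (2 * norm (k (\<phi> x))) * norm (f x)"
          using lim(3) \<phi>_nonneg by (intro mult_right_mono) simp_all
        then show "norm (s i (\<phi> x) * f x) \<le> 2 * norm (k (\<phi> x) * f x)" by (simp add: norm_mult)
      qed
    qed measurable
    ultimately show ?case by (rule LIMSEQ_unique)
  qed
qed

section \<open>Existence of a density with respect to the total variation\<close>

lemma total_variation_finite:
  assumes add: "bounded_additive \<nu>" and A: "A \<in> bounded_borel"
  shows "emeasure (total_variation \<nu>) A < \<infinity>"
proof -
  note Re = bounded_additive_Re[OF add] and Im = bounded_additive_Im[OF add]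
  define Rp Rn Ip In where
    parts: "Rp = jordan_pos (\<lambda>A. Re (\<nu> A))" "Rn = jordan_neg (\<lambda>A. Re (\<nu> A))"
           "Ip = jordan_pos (\<lambda>A. Im (\<nu> A))" "In = jordan_neg (\<lambda>A. Im (\<nu> A))"
  have fin: "emeasure Rp B < \<infinity>" "emeasure Rn B < \<infinity>" "emeasure Ip B < \<infinity>" "emeasure In B < \<infinity>"
    if "B \<in> bounded_borel" for B
    using that Re Im unfolding parts jordan_neg_def
    by (auto intro!: emeasure_jordan_pos_finite bounded_additive_uminus simp del: infinity_ennreal_def)
  \<comment> \<open>The sum of the four Jordan parts is a measure that dominates \<nu>, and it is
    finite on bounded sets; so the total variation is finite there too.\<close>
  have piece: "ennreal (norm (\<nu> B)) \<le> emeasure Rp B + emeasure Rn B + emeasure Ip B + emeasure In B"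
    if B: "B \<in> bounded_borel" for B
  proof -
    have "norm (\<nu> B) \<le> \<bar>Re (\<nu> B)\<bar> + \<bar>Im (\<nu> B)\<bar>" by (rule cmod_le)
    also have "\<dots> \<le> measure Rp B + measure Rn B + (measure Ip B + measure In B)"
      using jordan_decomposition[OF Re B] jordan_decomposition[OF Im B] unfolding parts
      by (intro add_mono) (simp_all add: abs_le_iff)
    finally have "ennreal (norm (\<nu> B)) \<le> ennreal (measure Rp B + measure Rn B + (measure Ip B + measure In B))"
      by (rule ennreal_leI)
    then show ?thesis
      using fin[OF B] by (simp add: emeasure_eq_ennreal_measure ennreal_plus[symmetric] less_top[symmetric] add.assoc
          del: ennreal_plus)
  qed
  have "emeasure (total_variation \<nu>) A \<le> emeasure Rp A + emeasure Rn A + emeasure Ip A + emeasure In A"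
    unfolding emeasure_total_variation[OF add bounded_borel_simps(3)[OF A]]
  proof (rule SUP_least)
    fix P assume P: "P \<in> {P. finite P \<and> disjoint P \<and> P \<subseteq> bounded_borel \<and> \<Union>P \<subseteq> A}"
    have le: "(\<Sum>B\<in>P. emeasure M B) \<le> emeasure M A" if "sets M = sets Rplus" for M
    proof (rule sum_emeasure_disjoint_le)
      show "P \<subseteq> sets M" unfolding that using P bounded_borel_simps(3) by blast
      show "A \<in> sets M" using A that by simp
    qed (use P in simp_all)
    have "ennreal (\<Sum>B\<in>P. norm (\<nu> B)) = (\<Sum>B\<in>P. ennreal (norm (\<nu> B)))" by (simp add: sum_ennreal)
    also have "\<dots> \<le> (\<Sum>B\<in>P. emeasure Rp B + emeasure Rn B + emeasure Ip B + emeasure In B)"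
      using P by (intro sum_mono piece) blast
    also have "\<dots> \<le> emeasure Rp A + emeasure Rn A + emeasure Ip A + emeasure In A"
      unfolding sum.distrib by (intro add_mono le) (simp_all add: parts)
    finally show "ennreal (\<Sum>B\<in>P. norm (\<nu> B)) \<le> emeasure Rp A + emeasure Rn A + emeasure Ip A + emeasure In A" .
  qed
  also have "\<dots> < \<infinity>" using fin[OF A] by simp
  finally show ?thesis .
qed

lemma sigma_finite_measure_Rplus:
  assumes "sets M = sets Rplus" "\<And>B. B \<in> bounded_borel \<Longrightarrow> emeasure M B < \<infinity>"
  shows "sigma_finite_measure M"
proof
  have "(\<Union>n. {0..real n}) = {0..}"
    using real_arch_simple by auto
  moreover have "space M = {0..}" using sets_eq_imp_space_eq[OF assms(1)] by simp
  moreover have "{0..real n} \<in> sets M" for n unfolding assms(1) by (rule bounded_borel_simps(3)) simp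
  moreover have "emeasure M {0..real n} \<noteq> \<infinity>" for n using assms(2)[of "{0..real n}"] by simp
  ultimately show "\<exists>A. countable A \<and> A \<subseteq> sets M \<and> \<Union>A = space M \<and> (\<forall>a\<in>A. emeasure M a \<noteq> \<infinity>)"
    by (intro exI[of _ "range (\<lambda>n. {0..real n})"]) auto
qed

lemma sigma_finite_total_variation:
  "bounded_additive \<nu> \<Longrightarrow> sigma_finite_measure (total_variation \<nu>)"
  by (intro sigma_finite_measure_Rplus sets_total_variation total_variation_finite)

text \<open>Domination gives absolute continuity. Sigma-finiteness of \<open>N\<close> makes the
  derivative finite almost everywhere, which allows a real-valued version.\<close>

lemma Radon_Nikodym_real_le:
  assumes "sigma_finite_measure M" "sigma_finite_measure N" "N \<le> M" "sets N = sets M"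
  shows "\<exists>d :: 'a \<Rightarrow> real. d \<in> borel_measurable M \<and> (\<forall>x. 0 \<le> d x) \<and> N = density M (\<lambda>x. ennreal (d x))"
proof (intro exI conjI)
  interpret M: sigma_finite_measure M by fact
  have ac: "absolutely_continuous M N"
    unfolding absolutely_continuous_def
  proof
    fix A assume A: "A \<in> null_sets M"
    have "emeasure N A \<le> emeasure M A" by (rule le_measureD3[OF assms(3,4)])
    with A show "A \<in> null_sets N" using assms(4) by (simp add: null_sets_def)
  qed
  let ?d = "\<lambda>x. enn2real (RN_deriv M N x)"
  show "?d \<in> borel_measurable M" by measurable
  show "\<forall>x. 0 \<le> ?d x" by simp
  have "density M (\<lambda>x. ennreal (?d x)) = density M (RN_deriv M N)"
  proof (rule density_cong)
    show "AE x in M. ennreal (?d x) = RN_deriv M N x"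
      using M.RN_deriv_finite[OF assms(2) ac assms(4)] by eventually_elim (simp add: less_top)
  qed measurable
  also have "\<dots> = N" by (rule M.density_RN_deriv[OF ac assms(4)])
  finally show "N = density M (\<lambda>x. ennreal (?d x))" ..
qed

text \<open>Each Jordan part has a density with respect to the total variation, and \<open>f\<close>
  combines the four. The factor 4 arises because \<open>norm (f t)\<close> is bounded by the sum of
  the four densities and each part lies below the total variation. The function \<open>f\<close> is
  chosen before \<open>w\<close>, so one density serves all weights.\<close>

lemma ex_represents_total_variation:
  assumes "\<nu> \<in> lf_measures"
  obtains f where "represents (total_variation \<nu>) (\<lambda>t. t) f \<nu>"
    and "\<And>w. w \<in> borel_measurable Rplus \<Longrightarrow>
      (\<integral>\<^sup>+t. ennreal (norm (f t)) * ennreal (w t) \<partial>total_variation \<nu>) \<le> 4 * wnorm w \<nu>"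
proof -
  have add: "bounded_additive \<nu>" using assms by (simp add: lf_measures_iff)
  note Re = bounded_additive_Re[OF add] and Im = bounded_additive_Im[OF add]
  let ?V = "total_variation \<nu>"
  have ex: "\<exists>d :: real \<Rightarrow> real. d \<in> borel_measurable Rplus \<and> (\<forall>x. 0 \<le> d x) \<and> N = density ?V (\<lambda>x. ennreal (d x))"
    if "N \<le> ?V" "sets N = sets Rplus" for N
  proof -
    have "emeasure N B < \<infinity>" if B: "B \<in> bounded_borel" for B
    proof -
      have "emeasure N B \<le> emeasure ?V B" using \<open>N \<le> ?V\<close> \<open>sets N = sets Rplus\<close> by (intro le_measureD3) simp_all
      also have "\<dots> < \<infinity>" by (rule total_variation_finite[OF add B])
      finally show ?thesis .
    qed
    then have "sigma_finite_measure N" using that by (intro sigma_finite_measure_Rplus) simp_all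
    then have "\<exists>d :: real \<Rightarrow> real. d \<in> borel_measurable ?V \<and> (\<forall>x. 0 \<le> d x) \<and> N = density ?V (\<lambda>x. ennreal (d x))"
      using that by (intro Radon_Nikodym_real_le sigma_finite_total_variation add) simp_all
    moreover have "(borel_measurable ?V :: (real \<Rightarrow> real) set) = borel_measurable Rplus"
      by (rule measurable_cong_sets) simp_all
    ultimately show ?thesis by simp
  qed
  obtain d1 where d1: "d1 \<in> borel_measurable Rplus" "\<And>x. 0 \<le> d1 x"
      "jordan_pos (\<lambda>A. Re (\<nu> A)) = density ?V (\<lambda>x. ennreal (d1 x))"
    using ex[OF jordan_parts_le_total_variation(1)[OF add] sets_jordan_pos] by blast
  obtain d2 where d2: "d2 \<in> borel_measurable Rplus" "\<And>x. 0 \<le> d2 x"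
      "jordan_neg (\<lambda>A. Re (\<nu> A)) = density ?V (\<lambda>x. ennreal (d2 x))"
    using ex[OF jordan_parts_le_total_variation(2)[OF add] sets_jordan_neg] by blast
  obtain d3 where d3: "d3 \<in> borel_measurable Rplus" "\<And>x. 0 \<le> d3 x"
      "jordan_pos (\<lambda>A. Im (\<nu> A)) = density ?V (\<lambda>x. ennreal (d3 x))"
    using ex[OF jordan_parts_le_total_variation(3)[OF add] sets_jordan_pos] by blast
  obtain d4 where d4: "d4 \<in> borel_measurable Rplus" "\<And>x. 0 \<le> d4 x"
      "jordan_neg (\<lambda>A. Im (\<nu> A)) = density ?V (\<lambda>x. ennreal (d4 x))"
    using ex[OF jordan_parts_le_total_variation(4)[OF add] sets_jordan_neg] by blast
  note [measurable] = d1(1) d2(1) d3(1) d4(1)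
  define f where "f x = Complex (d1 x - d2 x) (d3 x - d4 x)" for x
  have f_eq: "f = (\<lambda>x. complex_of_real (d1 x - d2 x) + \<i> * complex_of_real (d3 x - d4 x))"
    by (simp add: f_def complex_eq_iff fun_eq_iff)
  have f_meas [measurable]: "f \<in> borel_measurable Rplus" unfolding f_eq by measurable
  have norm_f: "norm (f x) \<le> d1 x + d2 x + d3 x + d4 x" for x
  proof -
    have "norm (f x) \<le> \<bar>d1 x - d2 x\<bar> + \<bar>d3 x - d4 x\<bar>" using cmod_le[of "f x"] by (simp add: f_def)
    also have "\<dots> \<le> d1 x + d2 x + d3 x + d4 x"
      using d1(2)[of x] d2(2)[of x] d3(2)[of x] d4(2)[of x] by linarith
    finally show ?thesis .
  qed
  have part: "integrable ?V (\<lambda>x. indicat_real A x * d x) \<and> (\<integral>x. indicat_real A x * d x \<partial>?V) = measure N A"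
    if N: "N = density ?V (\<lambda>x. ennreal (d x))" and d: "d \<in> borel_measurable Rplus" "\<And>x. 0 \<le> d x"
      and A: "A \<in> bounded_borel" and fin: "emeasure N A < \<infinity>" for N d A
  proof -
    have [measurable]: "A \<in> sets Rplus" using A by simp
    have sN: "sets N = sets Rplus" unfolding N by simp
    have [measurable]: "d \<in> borel_measurable Rplus" by fact
    have i: "integrable N (indicat_real A)" using fin by (simp add: sN)
    have m: "integral\<^sup>L N (indicat_real A) = measure N A"
      using sN sets.sets_into_space[of A N] by (simp add: Int_absorb2)
    show ?thesis
      using i m unfolding N by (subst (asm) integrable_density; subst (asm) integral_density)
        (simp_all add: d(2) mult.commute)
  qed
  show ?thesis
  proof (rule that[of f])
    show "represents ?V (\<lambda>t. t) f \<nu>"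
      unfolding represents_def
    proof (intro conjI ballI allI impI)
      show "\<nu> A = 0" if "A \<notin> bounded_borel" for A using assms that by (simp add: lf_measures_iff)
      show "(\<lambda>t. t) \<in> ?V \<rightarrow>\<^sub>M Rplus" by (rule measurable_ident_sets) simp
      show "f \<in> borel_measurable ?V" by measurable
      fix A assume A: "A \<in> bounded_borel"
      have fin: "emeasure (jordan_pos (\<lambda>A. Re (\<nu> A))) A < \<infinity>" "emeasure (jordan_neg (\<lambda>A. Re (\<nu> A))) A < \<infinity>"
        "emeasure (jordan_pos (\<lambda>A. Im (\<nu> A))) A < \<infinity>" "emeasure (jordan_neg (\<lambda>A. Im (\<nu> A))) A < \<infinity>"
        using A Re Im unfolding jordan_neg_def
        by (auto intro!: emeasure_jordan_pos_finite bounded_additive_uminus simp del: infinity_ennreal_def)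
      note p1 = part[OF d1(3,1,2) A fin(1)] and p2 = part[OF d2(3,1,2) A fin(2)]
        and p3 = part[OF d3(3,1,2) A fin(3)] and p4 = part[OF d4(3,1,2) A fin(4)]
      have eq: "(\<lambda>t. indicat_real A t *\<^sub>R f t) =
        (\<lambda>t. complex_of_real (indicat_real A t * d1 t - indicat_real A t * d2 t)
          + \<i> * complex_of_real (indicat_real A t * d3 t - indicat_real A t * d4 t))"
        by (simp add: f_eq scaleR_conv_of_real algebra_simps)
      \<comment> \<open>Splitting \<open>\<nu> A\<close> into real and imaginary parts and each of
        these into its Jordan difference matches the four densities inside \<open>f\<close> term by
        term.\<close>
      have "has_bochner_integral ?V (\<lambda>t. indicat_real A t *\<^sub>R f t)
        (complex_of_real (Re (\<nu> A)) + \<i> * complex_of_real (Im (\<nu> A)))"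
        unfolding eq jordan_decomposition[OF Re A] jordan_decomposition[OF Im A]
        using p1 p2 p3 p4
        by (intro has_bochner_integral_add has_bochner_integral_of_real has_bochner_integral_diff
            has_bochner_integral_mult_right) (simp_all add: has_bochner_integral_iff)
      then have "has_bochner_integral ?V (\<lambda>t. indicat_real A t *\<^sub>R f t) (\<nu> A)"
        by (simp add: complex_eq[symmetric])
      then show "integrable ?V (\<lambda>t. indicat_real A t *\<^sub>R f t)"
        "\<nu> A = (\<integral>t. indicat_real A t *\<^sub>R f t \<partial>?V)"
        by (simp_all add: has_bochner_integral_iff)
    qed
    fix w :: "real \<Rightarrow> real" assume w [measurable]: "w \<in> borel_measurable Rplus"
    have bnd: "(\<integral>\<^sup>+t. ennreal (d t) * ennreal (w t) \<partial>?V) \<le> wnorm w \<nu>"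
      if N: "N = density ?V (\<lambda>x. ennreal (d x))" "N \<le> ?V" and [measurable]: "d \<in> borel_measurable Rplus" for N d
    proof -
      have "(\<integral>\<^sup>+t. ennreal (d t) * ennreal (w t) \<partial>?V) = (\<integral>\<^sup>+t. ennreal (w t) \<partial>N)"
        unfolding N(1) by (simp add: nn_integral_density)
      also have "\<dots> \<le> wnorm w \<nu>"
        unfolding wnorm_def by (rule nn_integral_mono_measure[OF _ N(2)]) (simp add: N(1))
      finally show ?thesis .
    qed
    have "(\<integral>\<^sup>+t. ennreal (norm (f t)) * ennreal (w t) \<partial>?V) \<le>
      (\<integral>\<^sup>+t. (ennreal (d1 t) * ennreal (w t) + ennreal (d2 t) * ennreal (w t))
          + (ennreal (d3 t) * ennreal (w t) + ennreal (d4 t) * ennreal (w t)) \<partial>?V)"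
      using norm_f d1(2) d2(2) d3(2) d4(2)
      by (intro nn_integral_mono)
        (simp add: distrib_right[symmetric] ennreal_plus[symmetric] add.assoc mult_right_mono del: ennreal_plus)
    also have "\<dots> = ((\<integral>\<^sup>+t. ennreal (d1 t) * ennreal (w t) \<partial>?V) + (\<integral>\<^sup>+t. ennreal (d2 t) * ennreal (w t) \<partial>?V))
        + ((\<integral>\<^sup>+t. ennreal (d3 t) * ennreal (w t) \<partial>?V) + (\<integral>\<^sup>+t. ennreal (d4 t) * ennreal (w t) \<partial>?V))"
      by (simp add: nn_integral_add)
    also have "\<dots> \<le> (wnorm w \<nu> + wnorm w \<nu>) + (wnorm w \<nu> + wnorm w \<nu>)"
      using jordan_parts_le_total_variation[OF add]
      by (intro add_mono bnd[OF d1(3) _ d1(1)] bnd[OF d2(3) _ d2(1)] bnd[OF d3(3) _ d3(1)] bnd[OF d4(3) _ d4(1)])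
    also have "\<dots> = 4 * wnorm w \<nu>"
    proof -
      have "(4::ennreal) = (1 + 1) + (1 + 1)" by simp
      then show ?thesis by (simp only: distrib_right mult_1)
    qed
    finally show "(\<integral>\<^sup>+t. ennreal (norm (f t)) * ennreal (w t) \<partial>?V) \<le> 4 * wnorm w \<nu>" .
  qed
qed

section \<open>Convolution\<close>

text \<open>A representation is tested on bounded sets only, and over a set inside [0,T] the new
  factor \<open>\<phi>\<close> is at most \<open>T\<close>. So X acts on every represented measure,
  without any decay at infinity.\<close>

lemma represents_X_op:
  assumes rep: "represents \<Omega> \<phi> f \<nu>"
  shows "represents \<Omega> \<phi> (\<lambda>x. \<phi> x *\<^sub>R f x) (X_op \<nu>)"
  unfolding represents_def
proof (intro conjI ballI allI impI)
  note [measurable] = representsD(1,2)[OF rep]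
  show "\<phi> \<in> \<Omega> \<rightarrow>\<^sub>M Rplus" by measurable
  have \<phi> [measurable]: "\<phi> \<in> borel_measurable \<Omega>"
    using measurable_compose[OF representsD(1)[OF rep] measurable_restrict_space1[OF measurable_ident]] by simp
  show "(\<lambda>x. \<phi> x *\<^sub>R f x) \<in> borel_measurable \<Omega>" by measurable
  show "X_op \<nu> A = 0" if "A \<notin> bounded_borel" for A using that by (simp add: X_op_def)
  fix A assume A: "A \<in> bounded_borel"
  then have [measurable]: "A \<in> sets Rplus" by simp
  obtain T where T: "T \<ge> 0" "A \<subseteq> {0..T}" using bounded_borel_upper_bound[OF A] by blast
  have id: "(\<lambda>t. t) \<in> borel_measurable Rplus"
    by (rule measurable_restrict_space1) simp
  have meas: "(\<lambda>t. indicator A t * complex_of_real t) \<in> borel_measurable Rplus"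
    using id by measurable
  have eq: "indicator A (\<phi> x) * complex_of_real (\<phi> x) * f x = indicat_real A (\<phi> x) *\<^sub>R (\<phi> x *\<^sub>R f x)" for x
    by (simp add: scaleR_conv_of_real indicator_def)
  show int: "integrable \<Omega> (\<lambda>x. indicat_real A (\<phi> x) *\<^sub>R (\<phi> x *\<^sub>R f x))"
  proof (rule Bochner_Integration.integrable_bound)
    show "integrable \<Omega> (\<lambda>x. T *\<^sub>R (indicat_real A (\<phi> x) *\<^sub>R f x))"
      by (intro integrable_scaleR_right representsD(3)[OF rep A])
    show "AE x in \<Omega>. norm (indicat_real A (\<phi> x) *\<^sub>R (\<phi> x *\<^sub>R f x)) \<le> norm (T *\<^sub>R (indicat_real A (\<phi> x) *\<^sub>R f x))"
      using T by (intro AE_I2) (auto simp: indicator_def subset_iff intro!: mult_right_mono)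
  qed measurable
  show "X_op \<nu> A = (\<integral>x. indicat_real A (\<phi> x) *\<^sub>R (\<phi> x *\<^sub>R f x) \<partial>\<Omega>)"
    using A int cintegral_represents[OF rep meas] by (simp add: X_op_def eq)
qed

lemma nn_integral_pair_mult:
  assumes "sigma_finite_measure N"
    and [measurable]: "u \<in> borel_measurable M" "v \<in> borel_measurable N"
  shows "(\<integral>\<^sup>+z. u (fst z) * v (snd z) \<partial>(M \<Otimes>\<^sub>M N)) = (\<integral>\<^sup>+x. u x \<partial>M) * (\<integral>\<^sup>+y. v y \<partial>N)"
proof -
  interpret sigma_finite_measure N by fact
  show ?thesis
    by (subst nn_integral_fst[symmetric]) (simp_all add: nn_integral_cmult nn_integral_multc)
qed

lemma represents_integrable_bounded:
  assumes rep: "represents \<Omega> \<phi> f \<nu>" and [measurable]: "h \<in> borel_measurable Rplus"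
    and A: "A \<in> bounded_borel" and h: "\<And>t. t \<ge> 0 \<Longrightarrow> norm (h t) \<le> indicat_real A t"
  shows "integrable \<Omega> (\<lambda>x. h (\<phi> x) * f x)"
proof (rule Bochner_Integration.integrable_bound[OF representsD(3)[OF rep A]])
  note [measurable] = representsD(1,2)[OF rep]
  show "(\<lambda>x. h (\<phi> x) * f x) \<in> borel_measurable \<Omega>" by measurable
  show "AE x in \<Omega>. norm (h (\<phi> x) * f x) \<le> norm (indicat_real A (\<phi> x) *\<^sub>R f x)"
    using h measurable_space[OF representsD(1)[OF rep]]
    by (intro AE_I2) (simp add: norm_mult mult_right_mono)
qed

lemma measurable_add_Rplus [measurable]:
  assumes u: "u \<in> M \<rightarrow>\<^sub>M Rplus" and v: "v \<in> M \<rightarrow>\<^sub>M Rplus"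
  shows "(\<lambda>x. u x + v x) \<in> M \<rightarrow>\<^sub>M Rplus"
proof (rule measurable_restrict_space2)
  show "(\<lambda>x. u x + v x) \<in> space M \<rightarrow> {0..}"
    using measurable_space[OF u] measurable_space[OF v] by simp
  have "u \<in> borel_measurable M" "v \<in> borel_measurable M"
    using u v by (simp_all add: measurable_restrict_space2_iff)
  then show "(\<lambda>x. u x + v x) \<in> borel_measurable M" by measurable
qed

text \<open>Sigma-finiteness is not part of \<open>represents\<close>; it is added here because
  Fubini's theorem on the product needs it.\<close>

locale represented_pair =
  fixes \<Omega>1 :: "'a measure" and \<Omega>2 :: "'b measure" and \<phi> f \<nu> \<psi> g \<mu>
  assumes sigma_finite_spaces: "sigma_finite_measure \<Omega>1" "sigma_finite_measure \<Omega>2"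
    and rep1: "represents \<Omega>1 \<phi> f \<nu>" and rep2: "represents \<Omega>2 \<psi> g \<mu>"
begin

sublocale pair_sigma_finite \<Omega>1 \<Omega>2
  using sigma_finite_spaces by (simp add: pair_sigma_finite_def)

lemmas [measurable] = representsD(1,2)[OF rep1] representsD(1,2)[OF rep2]

lemma \<phi>_nonneg: "x \<in> space \<Omega>1 \<Longrightarrow> 0 \<le> \<phi> x" and \<psi>_nonneg: "y \<in> space \<Omega>2 \<Longrightarrow> 0 \<le> \<psi> y"
  using measurable_space[OF representsD(1)[OF rep1]] measurable_space[OF representsD(1)[OF rep2]] by simp_all

text \<open>The inner \<open>cintegral\<close> must be evaluated at every \<open>t\<close> of the
  half line, whereas Fubini's theorem yields integrable sections only for almost every point of the
  first space. Hence \<open>slice\<close> is a separate hypothesis.\<close>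

lemma cintegral_iterated:
  assumes [measurable]: "h \<in> borel_measurable Rplus"
    and slice: "\<And>t. t \<ge> 0 \<Longrightarrow> integrable \<Omega>2 (\<lambda>y. h (t + \<psi> y) * g y)"
    and int: "integrable (\<Omega>1 \<Otimes>\<^sub>M \<Omega>2) (\<lambda>z. h (\<phi> (fst z) + \<psi> (snd z)) * (f (fst z) * g (snd z)))"
  shows "cintegral \<nu> (\<lambda>t. cintegral \<mu> (\<lambda>s. h (t + s))) =
    (\<integral>z. h (\<phi> (fst z) + \<psi> (snd z)) * (f (fst z) * g (snd z)) \<partial>(\<Omega>1 \<Otimes>\<^sub>M \<Omega>2))"
proof -
  define k where "k t = (\<integral>y. h (t + \<psi> y) * g y \<partial>\<Omega>2)" for t
  have id [measurable]: "(\<lambda>t. t) \<in> Rplus \<rightarrow>\<^sub>M Rplus" by (rule measurable_ident_sets) simp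
  have k_meas [measurable]: "k \<in> borel_measurable Rplus"
    unfolding k_def by measurable
  have inner: "cintegral \<mu> (\<lambda>s. h (t + s)) = k t" if "t \<ge> 0" for t
  proof -
    have "(\<lambda>_. t) \<in> Rplus \<rightarrow>\<^sub>M Rplus" using that by simp
    then have "(\<lambda>s. h (t + s)) \<in> borel_measurable Rplus" by measurable
    then show ?thesis unfolding k_def by (rule cintegral_represents[OF rep2 _ slice[OF that]])
  qed
  have kf: "k (\<phi> x) * f x = (\<integral>y. h (\<phi> x + \<psi> y) * (f x * g y) \<partial>\<Omega>2)" for x
    unfolding k_def by (subst integral_mult_left_zero[symmetric]) (simp add: ac_simps)
  have "integrable \<Omega>1 (\<lambda>x. k (\<phi> x) * f x)"
    unfolding kf using integrable_fst'[OF int] by simp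
  then have "cintegral \<nu> k = (\<integral>x. k (\<phi> x) * f x \<partial>\<Omega>1)"
    by (rule cintegral_represents[OF rep1 k_meas])
  also have "\<dots> = (\<integral>z. h (\<phi> (fst z) + \<psi> (snd z)) * (f (fst z) * g (snd z)) \<partial>(\<Omega>1 \<Otimes>\<^sub>M \<Omega>2))"
    unfolding kf using integral_fst'[OF int] by simp
  finally show ?thesis using inner by (simp cong: cintegral_cong)
qed

text \<open>On the half line, \<open>t + s\<close> in a subset of [0,T] forces both \<open>t\<close>
  and \<open>s\<close> into [0,T]. The integrand is then dominated by a product of two local
  integrals, so the convolution of locally finite measures is again locally finite.\<close>

lemma represents_convolution:
  "represents (\<Omega>1 \<Otimes>\<^sub>M \<Omega>2) (\<lambda>z. \<phi> (fst z) + \<psi> (snd z)) (\<lambda>z. f (fst z) * g (snd z)) (convolution \<nu> \<mu>)"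
  unfolding represents_def
proof (intro conjI ballI allI impI)
  show "(\<lambda>z. \<phi> (fst z) + \<psi> (snd z)) \<in> \<Omega>1 \<Otimes>\<^sub>M \<Omega>2 \<rightarrow>\<^sub>M Rplus" by measurable
  show "(\<lambda>z. f (fst z) * g (snd z)) \<in> borel_measurable (\<Omega>1 \<Otimes>\<^sub>M \<Omega>2)" by measurable
  show "convolution \<nu> \<mu> A = 0" if "A \<notin> bounded_borel" for A using that by (simp add: convolution_def)
  fix A assume A: "A \<in> bounded_borel"
  then have A_meas [measurable]: "A \<in> sets Rplus" by simp
  obtain T where T: "T \<ge> 0" "A \<subseteq> {0..T}" using bounded_borel_upper_bound[OF A] by blast
  let ?I = "indicat_real {0..T}" and ?h = "indicator A :: real \<Rightarrow> complex"
  have I_meas [measurable]: "{0..T} \<in> sets Rplus" by (rule bounded_borel_simps(3)) simp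
  have int: "integrable (\<Omega>1 \<Otimes>\<^sub>M \<Omega>2) (\<lambda>z. ?h (\<phi> (fst z) + \<psi> (snd z)) * (f (fst z) * g (snd z)))"
    unfolding integrable_iff_bounded
  proof
    have "(\<integral>\<^sup>+z. ennreal (norm (?h (\<phi> (fst z) + \<psi> (snd z)) * (f (fst z) * g (snd z)))) \<partial>(\<Omega>1 \<Otimes>\<^sub>M \<Omega>2))
      \<le> (\<integral>\<^sup>+z. ennreal (norm (?I (\<phi> (fst z)) *\<^sub>R f (fst z))) * ennreal (norm (?I (\<psi> (snd z)) *\<^sub>R g (snd z))) \<partial>(\<Omega>1 \<Otimes>\<^sub>M \<Omega>2))"
    proof (rule nn_integral_mono)
      fix z assume "z \<in> space (\<Omega>1 \<Otimes>\<^sub>M \<Omega>2)"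
      then have "0 \<le> \<phi> (fst z)" "0 \<le> \<psi> (snd z)" by (auto simp: space_pair_measure \<phi>_nonneg \<psi>_nonneg)
      then show "ennreal (norm (?h (\<phi> (fst z) + \<psi> (snd z)) * (f (fst z) * g (snd z)))) \<le>
        ennreal (norm (?I (\<phi> (fst z)) *\<^sub>R f (fst z))) * ennreal (norm (?I (\<psi> (snd z)) *\<^sub>R g (snd z)))"
        using T by (auto simp: indicator_def norm_mult ennreal_mult subset_iff dest!: bspec)
    qed
    also have "\<dots> = (\<integral>\<^sup>+x. ennreal (norm (?I (\<phi> x) *\<^sub>R f x)) \<partial>\<Omega>1) * (\<integral>\<^sup>+y. ennreal (norm (?I (\<psi> y) *\<^sub>R g y)) \<partial>\<Omega>2)"
      by (rule nn_integral_pair_mult[OF sigma_finite_spaces(2)]) measurable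
    also have "\<dots> < \<infinity>"
      using representsD(3)[OF rep1 bounded_borel_Icc[of T]] representsD(3)[OF rep2 bounded_borel_Icc[of T]]
      by (simp add: integrable_iff_bounded ennreal_mult_less_top)
    finally show "(\<integral>\<^sup>+z. ennreal (norm (?h (\<phi> (fst z) + \<psi> (snd z)) * (f (fst z) * g (snd z)))) \<partial>(\<Omega>1 \<Otimes>\<^sub>M \<Omega>2)) < \<infinity>" .
  qed measurable
  have slice: "integrable \<Omega>2 (\<lambda>y. ?h (t + \<psi> y) * g y)" if "t \<ge> 0" for t
  proof (rule represents_integrable_bounded[OF rep2 _ bounded_borel_Icc[of T]])
    have [measurable]: "(\<lambda>_. t) \<in> Rplus \<rightarrow>\<^sub>M Rplus" using that by simp
    have [measurable]: "(\<lambda>t. t) \<in> Rplus \<rightarrow>\<^sub>M Rplus" by (rule measurable_ident_sets) simp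
    show "(\<lambda>s. ?h (t + s)) \<in> borel_measurable Rplus" by measurable
    show "norm (?h (t + s)) \<le> ?I s" if "s \<ge> 0" for s
      using T \<open>t \<ge> 0\<close> that by (auto simp: indicator_def subset_iff dest!: bspec)
  qed
  have eq: "?h a * b = indicat_real A a *\<^sub>R b" for a and b :: complex
    by (simp add: indicator_def)
  show "integrable (\<Omega>1 \<Otimes>\<^sub>M \<Omega>2) (\<lambda>z. indicat_real A (\<phi> (fst z) + \<psi> (snd z)) *\<^sub>R (f (fst z) * g (snd z)))"
    using int unfolding eq .
  have "?h \<in> borel_measurable Rplus" by measurable
  from cintegral_iterated[OF this slice int]
  show "convolution \<nu> \<mu> A =
    (\<integral>z. indicat_real A (\<phi> (fst z) + \<psi> (snd z)) *\<^sub>R (f (fst z) * g (snd z)) \<partial>(\<Omega>1 \<Otimes>\<^sub>M \<Omega>2))"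
    using A by (simp add: convolution_def eq)
qed

end

section \<open>Convolution with functions of weighted decay\<close>

lemma algebra_weightD:
  assumes "algebra_weight w"
  shows "w \<in> borel_measurable Rplus" "t \<ge> 0 \<Longrightarrow> 0 < w t"
    "T \<ge> 0 \<Longrightarrow> bounded (w ` {0..T})" "T \<ge> 0 \<Longrightarrow> bounded ((\<lambda>t. 1 / w t) ` {0..T})"
    "t \<ge> 0 \<Longrightarrow> s \<ge> 0 \<Longrightarrow> w (t + s) \<le> w t * w s"
  using assms unfolding algebra_weight_def by blast+

lemma borel_measurable_C0_inv: "h \<in> C0_inv w \<Longrightarrow> h \<in> borel_measurable Rplus"
  by (intro borel_measurable_continuous_on_restrict) (simp add: C0_inv_def)

text \<open>Beyond some \<open>T\<close> the quotient is below 1 because it tends to 0. On [0,T] the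
  function is bounded by compactness, and local boundedness of 1/w keeps the weight away from
  0.\<close>

lemma C0_inv_bounded_by_weight:
  assumes w: "algebra_weight w" and h: "h \<in> C0_inv w"
  obtains C where "C \<ge> 0" "\<And>t. t \<ge> 0 \<Longrightarrow> norm (h t) \<le> C * w t"
proof -
  have cont: "continuous_on {0..} h" and lim: "((\<lambda>t. h t / complex_of_real (w t)) \<longlongrightarrow> 0) at_top"
    using h by (auto simp: C0_inv_def)
  have "\<forall>\<^sub>F t in at_top. norm (h t / complex_of_real (w t)) < 1"
    using tendstoD[OF lim zero_less_one] by simp
  then obtain T0 where T0: "\<And>t. t \<ge> T0 \<Longrightarrow> norm (h t / complex_of_real (w t)) < 1"
    by (auto simp: eventually_at_top_linorder)
  define T where "T = max T0 0"
  have "compact (h ` {0..T})"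
    by (intro compact_continuous_image continuous_on_subset[OF cont]) auto
  then obtain K where K: "K > 0" "\<And>t. t \<in> {0..T} \<Longrightarrow> norm (h t) \<le> K"
    using compact_imp_bounded bounded_pos by (metis image_eqI)
  obtain L where L: "L > 0" "\<And>t. t \<in> {0..T} \<Longrightarrow> norm (1 / w t) \<le> L"
    using algebra_weightD(4)[OF w, of T] unfolding bounded_pos by (auto simp: T_def)
  show ?thesis
  \<comment> \<open>The entry 1 serves t > T; the entry \<open>K * L\<close> serves [0,T], where
    \<open>1 \<le> L * w t\<close>.\<close>
  proof (rule that[of "max 1 (K * L)"])
    fix t :: real assume t: "t \<ge> 0"
    have wt: "w t > 0" by (rule algebra_weightD(2)[OF w t])
    show "norm (h t) \<le> max 1 (K * L) * w t"
    proof (cases "t \<le> T")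
      case True
      have "1 \<le> L * w t" using L(2)[of t] wt t True by (simp add: divide_simps)
      then have "K * 1 \<le> K * (L * w t)" using K(1) by (intro mult_left_mono) simp_all
      with K(2)[of t] t True have "norm (h t) \<le> (K * L) * w t" by simp
      also have "\<dots> \<le> max 1 (K * L) * w t" using wt by (intro mult_right_mono) simp_all
      finally show ?thesis .
    next
      case False
      then have "norm (h t) < 1 * w t" using T0[of t] wt by (simp add: T_def norm_divide divide_simps)
      also have "\<dots> \<le> max 1 (K * L) * w t" using wt by (intro mult_right_mono) simp_all
      finally show ?thesis by simp
    qed
  qed simp
qed

lemma borel_measurable_shift:
  assumes "h \<in> borel_measurable Rplus" "t \<ge> 0" "sets V = sets Rplus"
  shows "(\<lambda>s. h (t + s)) \<in> borel_measurable V"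
proof -
  have [measurable]: "h \<in> borel_measurable Rplus" "(\<lambda>_. t) \<in> V \<rightarrow>\<^sub>M Rplus" "(\<lambda>s. s) \<in> V \<rightarrow>\<^sub>M Rplus"
    using assms by (auto intro: measurable_ident_sets)
  show ?thesis by measurable
qed

text \<open>The pair of \<open>V\<close> and the density \<open>g\<close> stands for an element of
  M(w), with \<open>wg\<close> as its finite norm. In the application \<open>V\<close> is the total
  variation of \<mu>, or of \<nu>.\<close>

context
  fixes w :: "real \<Rightarrow> real" and h g :: "real \<Rightarrow> complex" and V :: "real measure"
  assumes w: "algebra_weight w" and h: "h \<in> C0_inv w"
    and sets_V: "sets V = sets Rplus"
    and g: "g \<in> borel_measurable V" and wg: "integrable V (\<lambda>s. w s * norm (g s))"
begin

lemma space_V: "space V = {0..}" using sets_eq_imp_space_eq[OF sets_V] by simp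

lemma shift_measurable: "t \<ge> 0 \<Longrightarrow> (\<lambda>s. h (t + s) * g s) \<in> borel_measurable V"
  by (intro borel_measurable_times borel_measurable_shift borel_measurable_C0_inv[OF h] sets_V g)

lemma shift_bound:
  assumes C: "C \<ge> 0" "\<And>t. t \<ge> 0 \<Longrightarrow> norm (h t) \<le> C * w t" and t: "t \<ge> 0" and s: "s \<ge> 0"
  shows "norm (h (t + s) * g s) \<le> C * w t * (w s * norm (g s))"
proof -
  have "norm (h (t + s)) \<le> C * w (t + s)" using C(2) t s by simp
  also have "\<dots> \<le> C * (w t * w s)"
    using algebra_weightD(5)[OF w t s] C(1) by (rule mult_left_mono)
  finally have "norm (h (t + s)) * norm (g s) \<le> C * (w t * w s) * norm (g s)"
    by (rule mult_right_mono) simp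
  then show ?thesis by (simp add: norm_mult ac_simps)
qed

lemma shift_integrable:
  assumes t: "t \<ge> 0" shows "integrable V (\<lambda>s. h (t + s) * g s)"
proof -
  obtain C where C: "C \<ge> 0" "\<And>t. t \<ge> 0 \<Longrightarrow> norm (h t) \<le> C * w t"
    using C0_inv_bounded_by_weight[OF w h] by blast
  show ?thesis
  proof (rule Bochner_Integration.integrable_bound[OF _ shift_measurable[OF t]])
    show "integrable V (\<lambda>s. C * w t * (w s * norm (g s)))" by (intro integrable_mult_right wg)
    show "AE s in V. norm (h (t + s) * g s) \<le> norm (C * w t * (w s * norm (g s)))"
      using shift_bound[OF C t] by (intro AE_I2) (fastforce simp: space_V)
  qed
qed

lemma shift_integral_continuous: "continuous_on {0..} (\<lambda>t. \<integral>s. h (t + s) * g s \<partial>V)"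
  unfolding continuous_on_sequentially o_def
proof (intro allI ballI impI, elim conjE)
  fix x :: "nat \<Rightarrow> real" and a :: real
  assume a: "a \<in> {0..}" and x: "\<forall>n. x n \<in> {0..}" and lim: "x \<longlonglongrightarrow> a"
  obtain C where C: "C \<ge> 0" "\<And>t. t \<ge> 0 \<Longrightarrow> norm (h t) \<le> C * w t"
    using C0_inv_bounded_by_weight[OF w h] by blast
  obtain T where T: "T > 0" "\<And>n. norm (x n) \<le> T"
    using Bseq_def convergent_imp_Bseq[OF convergentI[OF lim]] by blast
  \<comment> \<open>The weight is only right continuous, so \<open>w (x n)\<close> need not
    converge. Local boundedness along the bounded sequence is what makes the majorant independent of
    \<open>n\<close>.\<close>
  obtain W where W: "W > 0" "\<And>t. t \<in> {0..T} \<Longrightarrow> norm (w t) \<le> W"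
    using algebra_weightD(3)[OF w, of T] T(1) unfolding bounded_pos by (auto simp del: real_norm_def)
  show "(\<lambda>n. \<integral>s. h (x n + s) * g s \<partial>V) \<longlonglongrightarrow> (\<integral>s. h (a + s) * g s \<partial>V)"
  proof (rule integral_dominated_convergence[where w = "\<lambda>s. C * W * (w s * norm (g s))"])
    show "(\<lambda>s. h (a + s) * g s) \<in> borel_measurable V" "(\<lambda>s. h (x n + s) * g s) \<in> borel_measurable V" for n
      using a x by (simp_all add: shift_measurable)
    show "integrable V (\<lambda>s. C * W * (w s * norm (g s)))" by (intro integrable_mult_right wg)
    show "AE s in V. (\<lambda>n. h (x n + s) * g s) \<longlonglongrightarrow> h (a + s) * g s"
    proof (intro AE_I2 tendsto_intros)
      fix s assume "s \<in> space V"
      then have s: "s \<ge> 0" by (simp add: space_V)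
      show "(\<lambda>n. h (x n + s)) \<longlonglongrightarrow> h (a + s)"
      proof (rule continuous_on_tendsto_compose[of "{0..}" h])
        show "continuous_on {0..} h" using h by (simp add: C0_inv_def)
        show "(\<lambda>n. x n + s) \<longlonglongrightarrow> a + s" by (intro tendsto_intros lim)
      qed (use a x s in simp_all)
    qed
    show "AE s in V. norm (h (x n + s) * g s) \<le> C * W * (w s * norm (g s))" for n
    proof (rule AE_I2)
      fix s assume "s \<in> space V"
      then have s: "s \<ge> 0" by (simp add: space_V)
      have xn: "x n \<ge> 0" "x n \<in> {0..T}" using x T(2)[of n] by (auto simp: abs_le_iff)
      have "norm (h (x n + s) * g s) \<le> C * w (x n) * (w s * norm (g s))" by (rule shift_bound[OF C xn(1) s])
      also have "\<dots> \<le> C * W * (w s * norm (g s))"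
        using W(2)[OF xn(2)] C(1) algebra_weightD(2)[OF w s]
        by (intro mult_right_mono mult_left_mono) simp_all
      finally show "norm (h (x n + s) * g s) \<le> C * W * (w s * norm (g s))" .
    qed
  qed
qed

lemma shift_integral_C0_inv: "(\<lambda>t. \<integral>s. h (t + s) * g s \<partial>V) \<in> C0_inv w"
  unfolding C0_inv_def
proof (intro CollectI conjI shift_integral_continuous)
  obtain C where C: "C \<ge> 0" "\<And>t. t \<ge> 0 \<Longrightarrow> norm (h t) \<le> C * w t"
    using C0_inv_bounded_by_weight[OF w h] by blast
  have lim: "((\<lambda>t. h t / complex_of_real (w t)) \<longlongrightarrow> 0) at_top" using h by (simp add: C0_inv_def)
  \<comment> \<open>Dominated convergence along \<open>at_top\<close> asks for measurability at
    every real parameter, but \<open>h\<close> and \<open>w\<close> are controlled on the half line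
    only. The cut-off \<open>max t 0\<close> changes nothing for nonnegative
    \<open>t\<close>.\<close>
  let ?k = "\<lambda>t s. h (max t 0 + s) * g s / complex_of_real (w (max t 0))"
  have "((\<lambda>t. integral\<^sup>L V (?k t)) \<longlongrightarrow> integral\<^sup>L V (\<lambda>_. 0 :: complex)) at_top"
  proof (rule integral_dominated_convergence_at_top[where w = "\<lambda>s. C * (w s * norm (g s))"])
    show "?k t \<in> borel_measurable V" for t by (intro borel_measurable_divide shift_measurable) simp_all
    show "integrable V (\<lambda>s. C * (w s * norm (g s)))" by (intro integrable_mult_right wg)
    show "AE s in V. ((\<lambda>t. ?k t s) \<longlongrightarrow> 0) at_top"
    proof (rule AE_I2)
      fix s assume "s \<in> space V"
      then have s: "s \<ge> 0" by (simp add: space_V)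
      have shifted: "((\<lambda>t. h (t + s) / complex_of_real (w (t + s))) \<longlongrightarrow> 0) at_top"
      proof (rule filterlim_compose[OF lim])
        show "filterlim (\<lambda>t. t + s) at_top at_top"
          using filterlim_tendsto_add_at_top[OF tendsto_const[of s] filterlim_ident]
          by (simp only: add.commute)
      qed
      show "((\<lambda>t. ?k t s) \<longlongrightarrow> 0) at_top"
      \<comment> \<open>For fixed \<open>s\<close> the quotient h(t+s)/w(t) is h(t+s)/w(t+s) times
        w(t+s)/w(t). The first factor tends to 0, and submultiplicativity bounds the second by
        w(s).\<close>
      proof (rule tendsto_0_le[OF shifted, of _ "w s * norm (g s)"])
        show "\<forall>\<^sub>F t in at_top. norm (?k t s) \<le> norm (h (t + s) / complex_of_real (w (t + s))) * (w s * norm (g s))"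
          using eventually_ge_at_top[of 0]
        proof eventually_elim
          case (elim t)
          have pos: "0 < w t" "0 < w (t + s)" "0 < w s" using algebra_weightD(2)[OF w] elim s by simp_all
          have "1 / w t \<le> w s / w (t + s)"
            using algebra_weightD(5)[OF w elim s] pos by (simp add: field_simps)
          then have "(1 / w t) * (norm (h (t + s)) * norm (g s)) \<le> (w s / w (t + s)) * (norm (h (t + s)) * norm (g s))"
            by (rule mult_right_mono) simp
          then show ?case using pos elim by (simp add: norm_mult norm_divide max_def ac_simps)
        qed
      qed
    qed
    show "\<forall>\<^sub>F t in at_top. AE s in V. norm (?k t s) \<le> C * (w s * norm (g s))"
    proof (rule always_eventually, rule allI, rule AE_I2)
      fix t s :: real assume "s \<in> space V"
      then have s: "s \<ge> 0" by (simp add: space_V)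
      have "norm (h (max t 0 + s) * g s) \<le> C * w (max t 0) * (w s * norm (g s))"
        by (rule shift_bound[OF C max.cobounded2 s])
      then show "norm (?k t s) \<le> C * (w s * norm (g s))"
        using algebra_weightD(2)[OF w, of "max t 0"] by (simp add: norm_mult norm_divide field_simps)
    qed
  qed simp
  moreover have "\<forall>\<^sub>F t in at_top. integral\<^sup>L V (?k t) = (\<integral>s. h (t + s) * g s \<partial>V) / complex_of_real (w t)"
    by (rule eventually_mono[OF eventually_ge_at_top[of 0]]) (simp add: max_def)
  ultimately show "((\<lambda>t. (\<integral>s. h (t + s) * g s \<partial>V) / complex_of_real (w t)) \<longlongrightarrow> 0) at_top"
    by (simp add: tendsto_cong)
qed

end

section \<open>The preadjoint on D(1/\<omega>) and the duality identity\<close>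

lemma SUP_ereal_less_top_bound:
  assumes "(SUP t\<in>{0..}. ereal (t * u t / v t)) < \<infinity>" and v: "\<And>t. t \<ge> 0 \<Longrightarrow> 0 < v t"
  obtains D where "D \<ge> 0" "\<And>t. t \<ge> 0 \<Longrightarrow> t * u t \<le> D * v t"
proof -
  let ?S = "SUP t\<in>{0..}. ereal (t * u t / v t)"
  have le: "ereal (t * u t / v t) \<le> ?S" if "t \<ge> 0" for t using that by (intro SUP_upper) simp
  \<comment> \<open>The term at t = 0 vanishes, which excludes minus infinity as the supremum and
    makes the constant nonnegative.\<close>
  then have "0 \<le> ?S" using le[of 0] by (simp add: zero_ereal_def)
  with assms(1) obtain D where D: "?S = ereal D" by (cases ?S) auto
  show ?thesis
  proof (rule that[of D])
    show "D \<ge> 0" using \<open>0 \<le> ?S\<close> unfolding D by simp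
    show "t * u t \<le> D * v t" if "t \<ge> 0" for t
      using le[OF that] v[OF that] unfolding D by (simp add: divide_le_eq)
  qed
qed

text \<open>Written with \<open>cintegral\<close> rather than with a density of \<mu>, so that it
  depends on \<mu> and \<open>h\<close> alone and not on a choice of representation.\<close>

definition Dbar_preadjoint :: "(real set \<Rightarrow> complex) \<Rightarrow> (real \<Rightarrow> complex) \<Rightarrow> real \<Rightarrow> complex" where
  "Dbar_preadjoint \<mu> h t = complex_of_real t * cintegral \<mu> (\<lambda>s. h (t + s))"

context
  fixes \<omega> :: "nat \<Rightarrow> real \<Rightarrow> real" and \<mu> :: "real set \<Rightarrow> complex"
  assumes weight: "\<And>n. algebra_weight (\<omega> n)"
    and deriv_cond: "\<And>n. \<exists>m. (SUP t\<in>{0..}. ereal (t * \<omega> n t / \<omega> m t)) < \<infinity>"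
    and mu: "\<mu> \<in> B_alg \<omega>"
begin

lemma weight_comparison:
  obtains m D where "D \<ge> 0" "\<And>t. t \<ge> 0 \<Longrightarrow> t * \<omega> n t \<le> D * \<omega> m t"
proof -
  obtain m where m: "(SUP t\<in>{0..}. ereal (t * \<omega> n t / \<omega> m t)) < \<infinity>"
    using deriv_cond by blast
  show ?thesis
    by (rule SUP_ereal_less_top_bound[OF m algebra_weightD(2)[OF weight]]) (assumption, rule that)
qed

lemma B_alg_density:
  assumes "\<nu> \<in> B_alg \<omega>"
  obtains f where "represents (total_variation \<nu>) (\<lambda>t. t) f \<nu>"
    and "\<And>n. integrable (total_variation \<nu>) (\<lambda>t. \<omega> n t * norm (f t))"
proof -
  have "\<nu> \<in> lf_measures" using assms by (auto simp: B_alg_def M_alg_def)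
  then obtain f where f: "represents (total_variation \<nu>) (\<lambda>t. t) f \<nu>"
    and bound: "\<And>w. w \<in> borel_measurable Rplus \<Longrightarrow>
      (\<integral>\<^sup>+t. ennreal (norm (f t)) * ennreal (w t) \<partial>total_variation \<nu>) \<le> 4 * wnorm w \<nu>"
    by (rule ex_represents_total_variation) blast
  note [measurable] = representsD(1,2)[OF f] algebra_weightD(1)[OF weight]
  have "integrable (total_variation \<nu>) (\<lambda>t. \<omega> n t * norm (f t))" for n
  proof (rule integrableI_bounded)
    have "(\<integral>\<^sup>+t. ennreal (norm (\<omega> n t * norm (f t))) \<partial>total_variation \<nu>)
      = (\<integral>\<^sup>+t. ennreal (norm (f t)) * ennreal (\<omega> n t) \<partial>total_variation \<nu>)"
      using algebra_weightD(2)[OF weight, of _ n]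
      by (intro nn_integral_cong) (simp add: ennreal_mult[symmetric] less_imp_le mult.commute abs_mult)
    also have "\<dots> \<le> 4 * wnorm (\<omega> n) \<nu>" by (rule bound) measurable
    also have "\<dots> < \<infinity>" using assms by (simp add: B_alg_def M_alg_def ennreal_mult_less_top)
    finally show "(\<integral>\<^sup>+t. ennreal (norm (\<omega> n t * norm (f t))) \<partial>total_variation \<nu>) < \<infinity>" .
  qed measurable
  then show ?thesis using f that by blast
qed

lemma Dbar_preadjoint_D_inv:
  assumes "h \<in> D_inv \<omega>"
  shows "Dbar_preadjoint \<mu> h \<in> D_inv \<omega>"
proof -
  obtain n where h: "h \<in> C0_inv (\<omega> n)" using assms by (auto simp: D_inv_def)
  obtain g where g: "represents (total_variation \<mu>) (\<lambda>t. t) g \<mu>"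
    and wg: "\<And>n. integrable (total_variation \<mu>) (\<lambda>t. \<omega> n t * norm (g t))"
    using B_alg_density[OF mu] by blast
  let ?k = "\<lambda>t. \<integral>s. h (t + s) * g s \<partial>total_variation \<mu>"
  have k: "?k \<in> C0_inv (\<omega> n)"
    by (rule shift_integral_C0_inv[OF weight h sets_total_variation representsD(2)[OF g] wg])
  have preadj_eq: "Dbar_preadjoint \<mu> h t = complex_of_real t * ?k t" if t: "t \<ge> 0" for t
  proof -
    have "(\<lambda>s. h (t + s)) \<in> borel_measurable Rplus"
      by (intro borel_measurable_shift borel_measurable_C0_inv[OF h] t refl)
    then have "cintegral \<mu> (\<lambda>s. h (t + s)) = ?k t"
      by (rule cintegral_represents[OF g])
        (rule shift_integrable[OF weight h sets_total_variation representsD(2)[OF g] wg t])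
    then show ?thesis by (simp add: Dbar_preadjoint_def)
  qed
  obtain m D where D: "D \<ge> 0" "\<And>t. t \<ge> 0 \<Longrightarrow> t * \<omega> n t \<le> D * \<omega> m t"
    by (rule weight_comparison[of n]) (rule that)
  have "Dbar_preadjoint \<mu> h \<in> C0_inv (\<omega> m)"
    unfolding C0_inv_def
  proof (intro CollectI conjI)
    have "continuous_on {0..} (\<lambda>t. complex_of_real t * ?k t)"
      using k by (intro continuous_intros) (simp add: C0_inv_def)
    then show "continuous_on {0..} (Dbar_preadjoint \<mu> h)"
      by (rule continuous_on_eq) (simp add: preadj_eq)
    have lim: "((\<lambda>t. ?k t / complex_of_real (\<omega> n t)) \<longlongrightarrow> 0) at_top" using k by (simp add: C0_inv_def)
    show "((\<lambda>t. Dbar_preadjoint \<mu> h t / complex_of_real (\<omega> m t)) \<longlongrightarrow> 0) at_top"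
    proof (rule tendsto_0_le[OF lim, of _ D])
      show "\<forall>\<^sub>F t in at_top. norm (Dbar_preadjoint \<mu> h t / complex_of_real (\<omega> m t)) \<le> norm (?k t / complex_of_real (\<omega> n t)) * D"
      proof (rule eventually_mono[OF eventually_ge_at_top[of 0]])
        fix t :: real assume t: "0 \<le> t"
        have pos: "0 < \<omega> n t" "0 < \<omega> m t" using algebra_weightD(2)[OF weight t] by simp_all
        have "t / \<omega> m t \<le> D / \<omega> n t" using D(2)[OF t] pos by (simp add: field_simps)
        then have "norm (?k t) * (t / \<omega> m t) \<le> norm (?k t) * (D / \<omega> n t)" by (rule mult_left_mono) simp
        then show "norm (Dbar_preadjoint \<mu> h t / complex_of_real (\<omega> m t)) \<le> norm (?k t / complex_of_real (\<omega> n t)) * D"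
          using pos t by (simp add: preadj_eq norm_mult norm_divide ac_simps)
      qed
    qed
  qed
  then show ?thesis by (auto simp: D_inv_def)
qed

text \<open>One choice of densities serves both membership of \<open>Dbar \<mu> \<nu>\<close> in
  B(\<omega>) and the duality identity. The last property bounds the norm of X \<nu> * \<mu>:
  submultiplicativity separates the variables, and the factor t is charged to the first one, at the
  price of a norm of \<nu> with another index.\<close>

lemma Dbar_represents:
  assumes "\<nu> \<in> B_alg \<omega>"
  obtains f g where
    "represents (total_variation \<nu>) (\<lambda>t. t) f \<nu>" "\<And>n. integrable (total_variation \<nu>) (\<lambda>t. \<omega> n t * norm (f t))"
    "represents (total_variation \<mu>) (\<lambda>t. t) g \<mu>" "\<And>n. integrable (total_variation \<mu>) (\<lambda>t. \<omega> n t * norm (g t))"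
    "represented_pair (total_variation \<nu>) (total_variation \<mu>) (\<lambda>t. t) (\<lambda>t. t *\<^sub>R f t) (X_op \<nu>) (\<lambda>t. t) g \<mu>"
    "\<And>n. (\<integral>\<^sup>+z. ennreal (norm (fst z *\<^sub>R f (fst z) * g (snd z))) * ennreal (\<omega> n (fst z + snd z))
        \<partial>(total_variation \<nu> \<Otimes>\<^sub>M total_variation \<mu>)) < \<infinity>"
proof -
  let ?V = "total_variation \<nu>" and ?U = "total_variation \<mu>"
  obtain g where g: "represents ?U (\<lambda>t. t) g \<mu>" "\<And>n. integrable ?U (\<lambda>t. \<omega> n t * norm (g t))"
    using B_alg_density[OF mu] by blast
  obtain f where f: "represents ?V (\<lambda>t. t) f \<nu>" "\<And>n. integrable ?V (\<lambda>t. \<omega> n t * norm (f t))"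
    using B_alg_density[OF assms] by blast
  have add: "bounded_additive \<nu>" "bounded_additive \<mu>"
    using assms mu by (auto simp: B_alg_def M_alg_def lf_measures_iff)
  have pair: "represented_pair ?V ?U (\<lambda>t. t) (\<lambda>t. t *\<^sub>R f t) (X_op \<nu>) (\<lambda>t. t) g \<mu>"
    by (intro represented_pair.intro sigma_finite_total_variation add represents_X_op f g)
  have fin: "(\<integral>\<^sup>+z. ennreal (norm (fst z *\<^sub>R f (fst z) * g (snd z))) * ennreal (\<omega> n (fst z + snd z))
        \<partial>(?V \<Otimes>\<^sub>M ?U)) < \<infinity>" for n
  proof -
    obtain m D where D: "D \<ge> 0" "\<And>t. t \<ge> 0 \<Longrightarrow> t * \<omega> n t \<le> D * \<omega> m t"
      by (rule weight_comparison[of n]) (rule that)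
    note [measurable] = representsD(2)[OF f(1)] representsD(2)[OF g(1)] algebra_weightD(1)[OF weight]
    have "(\<integral>\<^sup>+z. ennreal (norm (fst z *\<^sub>R f (fst z) * g (snd z))) * ennreal (\<omega> n (fst z + snd z)) \<partial>(?V \<Otimes>\<^sub>M ?U))
      \<le> (\<integral>\<^sup>+z. ennreal (D * (\<omega> m (fst z) * norm (f (fst z)))) * ennreal (\<omega> n (snd z) * norm (g (snd z))) \<partial>(?V \<Otimes>\<^sub>M ?U))"
    proof (rule nn_integral_mono)
      fix z assume "z \<in> space (?V \<Otimes>\<^sub>M ?U)"
      then obtain t s where z: "z = (t, s)" and ts: "t \<ge> 0" "s \<ge> 0" by (auto simp: space_pair_measure)
      have pos: "0 < \<omega> n t" "0 < \<omega> n s" "0 < \<omega> m t" "0 < \<omega> n (t + s)"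
        using algebra_weightD(2)[OF weight] ts by simp_all
      have "t * \<omega> n (t + s) \<le> t * (\<omega> n t * \<omega> n s)"
        using algebra_weightD(5)[OF weight ts] ts(1) by (rule mult_left_mono)
      also have "\<dots> = (t * \<omega> n t) * \<omega> n s" by simp
      also have "\<dots> \<le> (D * \<omega> m t) * \<omega> n s" using D(2)[OF ts(1)] pos by (intro mult_right_mono) simp_all
      finally have "t * \<omega> n (t + s) * (norm (f t) * norm (g s)) \<le> D * \<omega> m t * \<omega> n s * (norm (f t) * norm (g s))"
        by (rule mult_right_mono) simp
      \<comment> \<open>The right-hand side is a product of a function of \<open>t\<close> and a
        function of \<open>s\<close>, so its double integral splits into the norms of \<nu> for
        index \<open>m\<close> and of \<mu> for index \<open>n\<close>, up to constants.\<close>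
      then have "norm (t *\<^sub>R f t * g s) * \<omega> n (t + s) \<le> D * (\<omega> m t * norm (f t)) * (\<omega> n s * norm (g s))"
        using ts by (simp add: norm_mult ac_simps)
      then have "ennreal (norm (t *\<^sub>R f t * g s) * \<omega> n (t + s)) \<le> ennreal (D * (\<omega> m t * norm (f t)) * (\<omega> n s * norm (g s)))"
        by (rule ennreal_leI)
      then show "ennreal (norm (fst z *\<^sub>R f (fst z) * g (snd z))) * ennreal (\<omega> n (fst z + snd z))
        \<le> ennreal (D * (\<omega> m (fst z) * norm (f (fst z)))) * ennreal (\<omega> n (snd z) * norm (g (snd z)))"
        unfolding z fst_conv snd_conv using pos D(1)
        by (subst (1 2) ennreal_mult[symmetric]) simp_all
    qed
    also have "\<dots> = (\<integral>\<^sup>+t. ennreal (D * (\<omega> m t * norm (f t))) \<partial>?V) * (\<integral>\<^sup>+s. ennreal (\<omega> n s * norm (g s)) \<partial>?U)"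
      by (rule nn_integral_pair_mult[OF sigma_finite_total_variation[OF add(2)]]) measurable
    also have "\<dots> < \<infinity>"
    proof -
      have lt: "(\<integral>\<^sup>+t. ennreal (u t) \<partial>M) < \<infinity>" if "integrable M u" for M and u :: "real \<Rightarrow> real"
      proof -
        have "(\<integral>\<^sup>+t. ennreal (u t) \<partial>M) \<le> (\<integral>\<^sup>+t. ennreal (norm (u t)) \<partial>M)"
          by (intro nn_integral_mono ennreal_leI) simp
        also have "\<dots> < \<infinity>" using that by (simp add: integrable_iff_bounded)
        finally show ?thesis .
      qed
      have "(\<integral>\<^sup>+t. ennreal (D * (\<omega> m t * norm (f t))) \<partial>?V) < \<infinity>" by (intro lt integrable_mult_right f)
      moreover have "(\<integral>\<^sup>+s. ennreal (\<omega> n s * norm (g s)) \<partial>?U) < \<infinity>" by (intro lt g)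
      ultimately show ?thesis by (simp add: ennreal_mult_less_top)
    qed
    finally show ?thesis .
  qed
  show ?thesis by (rule that[OF f g pair fin])
qed

lemma Dbar_B_alg:
  assumes "\<nu> \<in> B_alg \<omega>"
  shows "Dbar \<mu> \<nu> \<in> B_alg \<omega>"
proof -
  obtain f g where *: "represented_pair (total_variation \<nu>) (total_variation \<mu>) (\<lambda>t. t) (\<lambda>t. t *\<^sub>R f t) (X_op \<nu>) (\<lambda>t. t) g \<mu>"
    and fin: "\<And>n. (\<integral>\<^sup>+z. ennreal (norm (fst z *\<^sub>R f (fst z) * g (snd z))) * ennreal (\<omega> n (fst z + snd z))
        \<partial>(total_variation \<nu> \<Otimes>\<^sub>M total_variation \<mu>)) < \<infinity>"
    by (rule Dbar_represents[OF assms]) (rule that)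
  note rep = represented_pair.represents_convolution[OF *]
  have "wnorm (\<omega> n) (Dbar \<mu> \<nu>) < \<infinity>" for n
    using represents_wnorm_le[OF rep algebra_weightD(1)[OF weight, of n]] fin[of n]
    unfolding Dbar_def by (rule le_less_trans)
  moreover have "Dbar \<mu> \<nu> \<in> lf_measures"
    unfolding Dbar_def by (rule represents_lf_measures[OF rep])
  ultimately show ?thesis by (simp add: B_alg_def M_alg_def)
qed

text \<open>Both sides are evaluated as integrals of densities: the left one over the product space,
  then as an iterated integral. The operator X enters only as a factor t in the density, and reading
  that factor as part of the test function gives the right side.\<close>

lemma cintegral_Dbar:
  assumes \<nu>: "\<nu> \<in> B_alg \<omega>" and "h \<in> D_inv \<omega>"
  shows "cintegral (Dbar \<mu> \<nu>) h = cintegral \<nu> (Dbar_preadjoint \<mu> h)"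
proof -
  obtain n where h: "h \<in> C0_inv (\<omega> n)" using assms(2) by (auto simp: D_inv_def)
  let ?V = "total_variation \<nu>" and ?U = "total_variation \<mu>"
  obtain f g where f: "represents ?V (\<lambda>t. t) f \<nu>" "\<And>n. integrable ?V (\<lambda>t. \<omega> n t * norm (f t))"
    and g: "represents ?U (\<lambda>t. t) g \<mu>" "\<And>n. integrable ?U (\<lambda>t. \<omega> n t * norm (g t))"
    and pair: "represented_pair ?V ?U (\<lambda>t. t) (\<lambda>t. t *\<^sub>R f t) (X_op \<nu>) (\<lambda>t. t) g \<mu>"
    and fin: "\<And>n. (\<integral>\<^sup>+z. ennreal (norm (fst z *\<^sub>R f (fst z) * g (snd z))) * ennreal (\<omega> n (fst z + snd z)) \<partial>(?V \<Otimes>\<^sub>M ?U)) < \<infinity>"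
    by (rule Dbar_represents[OF \<nu>]) (rule that)
  interpret represented_pair ?V ?U "\<lambda>t. t" "\<lambda>t. t *\<^sub>R f t" "X_op \<nu>" "\<lambda>t. t" g \<mu> by (rule pair)
  have h_meas [measurable]: "h \<in> borel_measurable Rplus" by (rule borel_measurable_C0_inv[OF h])
  obtain C where C: "C \<ge> 0" "\<And>t. t \<ge> 0 \<Longrightarrow> norm (h t) \<le> C * \<omega> n t"
    using C0_inv_bounded_by_weight[OF weight h] by blast
  have int: "integrable (?V \<Otimes>\<^sub>M ?U) (\<lambda>z. h (fst z + snd z) * (fst z *\<^sub>R f (fst z) * g (snd z)))"
  proof (rule integrableI_bounded)
    note [measurable] = representsD(2)[OF represents_convolution] algebra_weightD(1)[OF weight]
    show "(\<lambda>z. h (fst z + snd z) * (fst z *\<^sub>R f (fst z) * g (snd z))) \<in> borel_measurable (?V \<Otimes>\<^sub>M ?U)"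
      by measurable
    have "(\<integral>\<^sup>+z. ennreal (norm (h (fst z + snd z) * (fst z *\<^sub>R f (fst z) * g (snd z)))) \<partial>(?V \<Otimes>\<^sub>M ?U))
      \<le> (\<integral>\<^sup>+z. ennreal C * (ennreal (norm (fst z *\<^sub>R f (fst z) * g (snd z))) * ennreal (\<omega> n (fst z + snd z))) \<partial>(?V \<Otimes>\<^sub>M ?U))"
    proof (rule nn_integral_mono)
      fix z assume "z \<in> space (?V \<Otimes>\<^sub>M ?U)"
      then have z: "fst z + snd z \<ge> 0" by (auto simp: space_pair_measure)
      have "norm (h (fst z + snd z) * (fst z *\<^sub>R f (fst z) * g (snd z)))
        \<le> C * \<omega> n (fst z + snd z) * norm (fst z *\<^sub>R f (fst z) * g (snd z))"
        unfolding norm_mult[of "h _"] by (rule mult_right_mono[OF C(2)[OF z]]) simp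
      also have "\<dots> = C * (norm (fst z *\<^sub>R f (fst z) * g (snd z)) * \<omega> n (fst z + snd z))" by (simp add: ac_simps)
      finally have "ennreal (norm (h (fst z + snd z) * (fst z *\<^sub>R f (fst z) * g (snd z))))
        \<le> ennreal (C * (norm (fst z *\<^sub>R f (fst z) * g (snd z)) * \<omega> n (fst z + snd z)))"
        by (rule ennreal_leI)
      then show "ennreal (norm (h (fst z + snd z) * (fst z *\<^sub>R f (fst z) * g (snd z))))
        \<le> ennreal C * (ennreal (norm (fst z *\<^sub>R f (fst z) * g (snd z))) * ennreal (\<omega> n (fst z + snd z)))"
        using C(1) less_imp_le[OF algebra_weightD(2)[OF weight z]] by (simp only: ennreal_mult norm_ge_zero mult_nonneg_nonneg)
    qed
    also have "\<dots> = ennreal C * (\<integral>\<^sup>+z. ennreal (norm (fst z *\<^sub>R f (fst z) * g (snd z))) * ennreal (\<omega> n (fst z + snd z)) \<partial>(?V \<Otimes>\<^sub>M ?U))"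
      by (rule nn_integral_cmult) measurable
    also have "\<dots> < \<infinity>" using fin[of n] by (simp add: ennreal_mult_less_top)
    finally show "(\<integral>\<^sup>+z. ennreal (norm (h (fst z + snd z) * (fst z *\<^sub>R f (fst z) * g (snd z)))) \<partial>(?V \<Otimes>\<^sub>M ?U)) < \<infinity>" .
  qed
  have slice: "integrable ?U (\<lambda>s. h (t + s) * g s)" if "t \<ge> 0" for t
    by (rule shift_integrable[OF weight h sets_total_variation representsD(2)[OF g(1)] g(2) that])
  define k where "k t = cintegral \<mu> (\<lambda>s. h (t + s))" for t
  have k_eq: "k t = (\<integral>s. h (t + s) * g s \<partial>?U)" if t: "t \<ge> 0" for t
    unfolding k_def
    by (rule cintegral_represents[OF g(1) borel_measurable_shift[OF h_meas t refl] slice[OF t]])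
  have adj: "Dbar_preadjoint \<mu> h \<in> borel_measurable Rplus" and adj_C0: "Dbar_preadjoint \<mu> h \<in> D_inv \<omega>"
    using Dbar_preadjoint_D_inv[OF assms(2)] by (auto simp: D_inv_def intro: borel_measurable_C0_inv)
  have k_meas: "k \<in> borel_measurable Rplus"
  proof -
    have "continuous_on {0..} (\<lambda>t. \<integral>s. h (t + s) * g s \<partial>?U)"
      by (rule shift_integral_continuous[OF weight h sets_total_variation representsD(2)[OF g(1)] g(2)])
    then have "continuous_on {0..} k" by (rule continuous_on_eq) (simp add: k_eq)
    then show ?thesis by (rule borel_measurable_continuous_on_restrict)
  qed
  have comm: "k t * (t *\<^sub>R f t) = Dbar_preadjoint \<mu> h t * f t" for t
    by (simp add: Dbar_preadjoint_def k_def scaleR_conv_of_real)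
  have int_adj: "integrable ?V (\<lambda>t. Dbar_preadjoint \<mu> h t * f t)"
  proof -
    obtain m where m: "Dbar_preadjoint \<mu> h \<in> C0_inv (\<omega> m)" using adj_C0 by (auto simp: D_inv_def)
    show ?thesis
      \<comment> \<open>The shift by 0 expresses that an element of C_0(1/\<omega>_m) is integrable
        against an element of M(\<omega>_m).\<close>
      using shift_integrable[OF weight m sets_total_variation representsD(2)[OF f(1)] f(2), of 0] by simp
  qed
  have "cintegral (Dbar \<mu> \<nu>) h = (\<integral>z. h (fst z + snd z) * (fst z *\<^sub>R f (fst z) * g (snd z)) \<partial>(?V \<Otimes>\<^sub>M ?U))"
    unfolding Dbar_def by (rule cintegral_represents[OF represents_convolution h_meas int])
  also have "\<dots> = cintegral (X_op \<nu>) k"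
    unfolding k_def by (rule cintegral_iterated[OF h_meas slice int, symmetric])
  also have "\<dots> = (\<integral>t. k t * (t *\<^sub>R f t) \<partial>?V)"
    using int_adj by (intro cintegral_represents[OF rep1 k_meas]) (simp only: comm)
  also have "\<dots> = cintegral \<nu> (Dbar_preadjoint \<mu> h)"
    unfolding comm by (rule cintegral_represents[OF f(1) adj int_adj, symmetric])
  finally show ?thesis .
qed

end

theorem proposition4p2:
  fixes \<omega> :: "nat \<Rightarrow> real \<Rightarrow> real" and \<mu> :: "real set \<Rightarrow> complex"
  assumes weight: "\<And>n. algebra_weight (\<omega> n)"
    and increasing: "\<And>n t. t \<ge> 0 \<Longrightarrow> \<omega> n t \<le> \<omega> (Suc n) t"
    and infty: "\<And>n. filterlim (\<omega> n) at_top at_top"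
    and radical: "\<And>n. ((\<lambda>t. \<omega> n t powr (1 / t)) \<longlongrightarrow> 1) at_top"
    and strict: "\<And>n. (SUP t\<in>{0..}. ereal (\<omega> (Suc n) t / \<omega> n t)) = \<infinity>"
    and deriv_cond: "\<And>n. \<exists>m. (SUP t\<in>{0..}. ereal (t * \<omega> n t / \<omega> m t)) < \<infinity>"
    and mu: "\<mu> \<in> B_alg \<omega>"
  shows "continuous_map (weak_star \<omega>) (weak_star \<omega>) (Dbar \<mu>)"
proof -
  let ?N = "\<lambda>h U. {\<nu> \<in> B_alg \<omega>. cintegral \<nu> h \<in> U}"
  let ?S = "{?N h U | h U. h \<in> D_inv \<omega> \<and> open U}"
  have B: "Dbar \<mu> \<nu> \<in> B_alg \<omega>" if "\<nu> \<in> B_alg \<omega>" for \<nu>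
    using weight deriv_cond mu that by (rule Dbar_B_alg)
  have "continuous_map (weak_star \<omega>) (topology_generated_by ?S) (Dbar \<mu>)"
  proof (rule continuous_on_generated_topo)
    fix W assume "W \<in> ?S"
    then obtain h U where W: "W = ?N h U" and h: "h \<in> D_inv \<omega>" and U: "open U" by blast
    have adj: "cintegral (Dbar \<mu> \<nu>) h = cintegral \<nu> (Dbar_preadjoint \<mu> h)" if "\<nu> \<in> B_alg \<omega>" for \<nu>
      using weight deriv_cond mu that h by (rule cintegral_Dbar)
    \<comment> \<open>The duality identity turns the preimage of a subbasic set into the subbasic
      set of the preadjoint function with the same \<open>U\<close>. That \<nu> \<mapsto> X \<nu> *
      \<mu> maps B(\<omega>) into itself removes the membership condition on the image.\<close>
    have "Dbar \<mu> -` W \<inter> topspace (weak_star \<omega>) = ?N (Dbar_preadjoint \<mu> h) U"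
      unfolding W topspace_weak_star using B adj by auto
    moreover have "Dbar_preadjoint \<mu> h \<in> D_inv \<omega>" using weight deriv_cond mu h by (rule Dbar_preadjoint_D_inv)
    then have "?N (Dbar_preadjoint \<mu> h) U \<in> ?S" using U by blast
    then have "openin (weak_star \<omega>) (?N (Dbar_preadjoint \<mu> h) U)"
      unfolding weak_star_def by (rule topology_generated_by_Basis)
    ultimately show "openin (weak_star \<omega>) (Dbar \<mu> -` W \<inter> topspace (weak_star \<omega>))" by simp
  next
    have "\<Union>?S = B_alg \<omega>"
      using topspace_weak_star[of \<omega>] unfolding weak_star_def topology_generated_by_topspace .
    then show "Dbar \<mu> ` topspace (weak_star \<omega>) \<subseteq> \<Union>?S" using B by (auto simp: topspace_weak_star)
  qed
  then show ?thesis by (simp only: weak_star_def)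
qed

end
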